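(* Let $G$ be a finite abelian group (written additively) with $\exp(G)=n$, and let $S=A\cup B$ be a subset of $G\setminus\{0\}$, where $A\cap B=\emptyset$, $A=-A$ and $B\cap(-B)=\emptyset$. Let $F=\{k\in\mathbb{Z}_{4n}^*\mid k\equiv 1\pmod 4\}$ and $$\mathcal{H}=\{h\in\mathbb{Z}_{4n}^*\mid hA=A,\ \text{and } hB=B \text{ if } h\in F,\ \text{and } hB=-B \text{ if } h\in -F\}.$$ Let $\eta:\mathrm{Gal}(\mathbb{Q}(\zeta_{4n})/\mathbb{Q})\to\mathbb{Z}_{4n}^*$ be the group isomorphism determined by $\sigma(\zeta_{4n})=\zeta_{4n}^{\eta(\sigma)}$. Then the splitting field of the mixed Cayley graph $\Gamma=\mathrm{Cay}(G,S)$ is $$\mathbb{SF}(\Gamma)=\mathbb{Q}(\zeta_{4n})^{\eta^{-1}(\mathcal{H})}:=\{x\in\mathbb{Q}(\zeta_{4n})\mid \sigma(x)=x\text{ for all }\sigma\in\eta^{-1}(\mathcal{H})\}.$$ Furthermore, the algebraic degree of $\Gamma$ is $$\mathrm{deg}(\Gamma)=\varphi(4n)/|\mathcal{H}|,$$ where $\varphi$ is Euler's totient function.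
   Context: A mixed graph $\Gamma=(V,E,\vec{E})$ has a vertex set $V$, a set $E$ of undirected edges $uv$ and a set $\vec{E}$ of directed edges (arcs) $(u,v)$, with no multiple edges and no loops. Its Hermitian adjacency matrix is $H(\Gamma)=(h_{uv})_{u,v\in V}$ with $h_{uv}=1$ if $uv\in E$, $h_{uv}=\mathbf{i}$ if $(u,v)\in\vec{E}$, $h_{uv}=-\mathbf{i}$ if $(v,u)\in\vec{E}$, and $h_{uv}=0$ otherwise, where $\mathbf{i}=\sqrt{-1}$. The eigenvalues of $H(\Gamma)$ are the Hermitian eigenvalues of $\Gamma$. The splitting field $\mathbb{SF}(\Gamma)$ is the smallest extension of $\mathbb{Q}$ (inside $\mathbb{C}$) over which the characteristic polynomial of $H(\Gamma)$ splits into linear factors, i.e. the field generated over $\mathbb{Q}$ by all Hermitian eigenvalues. The algebraic degree is $\mathrm{deg}(\Gamma)=[\mathbb{SF}(\Gamma):\mathbb{Q}]$. For an additive abelian group $G$ and $S=A\cup B\subseteq G\setminus\{0\}$ with $A\cap B=\emptyset$, $A=-A$, $B\cap(-B)=\emptyset$, the mixed Cayley graph $\mathrm{Cay}(G,S)$ has vertex set $G$, an undirected edge between $g$ and $h$ if $h-g\in A$, and an arc from $g$ to $h$ if $h-g\in B$. The exponent $\exp(G)$ is the least common multiple of the orders of the elements of $G$. $\zeta_t=\exp(2\pi\mathbf{i}/t)$; $\mathbb{Z}_t^*$ is the multiplicative group of units of the ring $\mathbb{Z}_t$ of integers modulo $t$. $\mathbb{Z}_{4n}^*$ acts on $G$ by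 $k\cdot g=kg$ (the $k$-th multiple of $g$, well defined since $ng=0$), and for $X\subseteq G$, $kX=\{kx\mid x\in X\}$ and $-X=\{-x\mid x\in X\}$. Also $-F=\{-k\mid k\in F\}=\{k\in\mathbb{Z}_{4n}^*\mid k\equiv 3\pmod 4\}$. *)

theory Defs
  imports
    "HOL-Analysis.Analysis"
    "HOL-Computational_Algebra.Polynomial"
    "HOL-Number_Theory.Totient"
    "HOL-Number_Theory.Cong"
    "HOL-Algebra.Elementary_Groups"
    "HOL-Algebra.Finite_Extensions"
    "HOL-Algebra.Generated_Fields"
    "HOL-Algebra.QuotRing"
    "HOL-Algebra.Algebraic_Closure_Type"
begin

section \<open>Mixed graphs and their Hermitian adjacency matrices\<close>

text \<open>The vertex set is the whole finite type \<open>'v\<close>.\<close>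

record 'v mixed_graph =
  edges :: "'v set set"
  arcs :: "('v \<times> 'v) set"

definition wf_mixed_graph :: "'v mixed_graph \<Rightarrow> bool" where
  "wf_mixed_graph \<Gamma> \<longleftrightarrow>
     (\<forall>e\<in>edges \<Gamma>. card e = 2) \<and>
     (\<forall>(u, v)\<in>arcs \<Gamma>. u \<noteq> v \<and> (v, u) \<notin> arcs \<Gamma> \<and> {u, v} \<notin> edges \<Gamma>)"

definition hermitian_adjacency :: "('v::finite) mixed_graph \<Rightarrow> complex ^ 'v ^ 'v" where
  "hermitian_adjacency \<Gamma> =
     (\<chi> u v. if {u, v} \<in> edges \<Gamma> then 1
             else if (u, v) \<in> arcs \<Gamma> then \<i>
             else if (v, u) \<in> arcs \<Gamma> then - \<i>
             else 0)"

definition charpoly :: "complex ^ 'v ^ 'v \<Rightarrow> complex poly" where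
  "charpoly M = det (mat [:0, 1:] - map_matrix (\<lambda>c. [:c:]) M)"


section \<open>Number fields inside the complex numbers\<close>

abbreviation complex_ring :: "complex ring" where
  "complex_ring \<equiv> ring_of_type_algebra"

definition splits_over :: "complex set \<Rightarrow> complex poly \<Rightarrow> bool" where
  "splits_over K p \<longleftrightarrow>
     (\<exists>c\<in>K. \<exists>rs. set rs \<subseteq> K \<and> p = Polynomial.smult c (\<Prod>r\<leftarrow>rs. [:- r, 1:]))"

text \<open>The hull is the intersection of all subfields over which the characteristic polynomial
  splits. It is itself one of them, because the multiset of complex roots is unique.\<close>

definition splitting_field :: "('v::finite) mixed_graph \<Rightarrow> complex set" where
  "splitting_field \<Gamma> =
     (\<lambda>K. subfield K complex_ring \<and> splits_over K (charpoly (hermitian_adjacency \<Gamma>))) hull \<rat>"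

definition algebraic_degree :: "('v::finite) mixed_graph \<Rightarrow> nat" where
  "algebraic_degree \<Gamma> = ring.dim complex_ring \<rat> (splitting_field \<Gamma>)"

definition zeta :: "nat \<Rightarrow> complex" where
  "zeta t = exp (2 * of_real pi * \<i> / of_nat t)"

definition cyclotomic_field :: "nat \<Rightarrow> complex set" where
  "cyclotomic_field t = generate_field complex_ring (\<rat> \<union> {zeta t})"

text \<open>Automorphisms are extensional (\<open>undefined\<close> outside \<open>L\<close>), so that distinct members of
  the Galois group are distinct as maps on \<open>L\<close>.\<close>

definition galois_group :: "complex set \<Rightarrow> complex set \<Rightarrow> (complex \<Rightarrow> complex) set" where
  "galois_group L K =
     {\<sigma> \<in> ring_iso (complex_ring\<lparr>carrier := L\<rparr>) (complex_ring\<lparr>carrier := L\<rparr>).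
        \<sigma> \<in> extensional L \<and> (\<forall>x\<in>K. \<sigma> x = x)}"

definition fixed_field :: "complex set \<Rightarrow> (complex \<Rightarrow> complex) set \<Rightarrow> complex set" where
  "fixed_field L P = {x \<in> L. \<forall>\<sigma>\<in>P. \<sigma> x = x}"

text \<open>The units modulo \<open>t\<close> are represented by their least positive residues,
  \<^const>\<open>totatives\<close> \<open>t\<close>.\<close>

definition eta :: "nat \<Rightarrow> (complex \<Rightarrow> complex) \<Rightarrow> nat" where
  "eta t \<sigma> = (THE k. k \<in> totatives t \<and> \<sigma> (zeta t) = zeta t ^ k)"


section \<open>Mixed Cayley graphs\<close>

definition mixed_cayley :: "'g::ab_group_add set \<Rightarrow> 'g set \<Rightarrow> 'g mixed_graph" where
  "mixed_cayley A B =
     \<lparr>edges = {{g, h} |g h. h - g \<in> A}, arcs = {(g, h). h - g \<in> B}\<rparr>"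

definition additive_group :: "('g::ab_group_add) monoid" where
  "additive_group = \<lparr>carrier = UNIV, mult = (+), one = 0\<rparr>"

definition group_exponent :: "('a, 'b) monoid_scheme \<Rightarrow> nat" where
  "group_exponent G = Lcm (group.ord G ` carrier G)"

text \<open>\<open>dilate k T\<close> is \<open>{k t | t \<in> T}\<close>, multiples being powers in \<^const>\<open>additive_group\<close>.\<close>

definition dilate :: "nat \<Rightarrow> 'g::ab_group_add set \<Rightarrow> 'g set" where
  "dilate k T = (\<lambda>x. x [^]\<^bsub>additive_group\<^esub> k) ` T"

definition units_1_mod_4 :: "nat \<Rightarrow> nat set" where
  "units_1_mod_4 n = {k \<in> totatives (4 * n). [k = 1] (mod 4)}"

text \<open>The negatives modulo \<open>4 * n\<close> of the elements of \<^const>\<open>units_1_mod_4\<close>.\<close>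

definition neg_units_1_mod_4 :: "nat \<Rightarrow> nat set" where
  "neg_units_1_mod_4 n = (\<lambda>k. 4 * n - k) ` units_1_mod_4 n"

definition unit_stabilizer :: "nat \<Rightarrow> 'g::ab_group_add set \<Rightarrow> 'g set \<Rightarrow> nat set" where
  "unit_stabilizer n A B =
     {h \<in> totatives (4 * n).
        dilate h A = A \<and>
        (h \<in> units_1_mod_4 n \<longrightarrow> dilate h B = B) \<and>
        (h \<in> neg_units_1_mod_4 n \<longrightarrow> dilate h B = uminus ` B)}"


section \<open>Consistency of the encodings\<close>

lemma wf_mixed_cayley:
  fixes A B :: "'g::ab_group_add set"
  assumes "0 \<notin> A \<union> B" "A \<inter> B = {}" "uminus ` A = A" "B \<inter> uminus ` B = {}"
  shows "wf_mixed_graph (mixed_cayley A B)"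
proof -
  have A: "- x \<in> A" if "x \<in> A" for x
    using that assms(3) by blast
  have B: "- x \<notin> B" if "x \<in> B" for x
    using that assms(4) by (metis IntI empty_iff imageI minus_minus)
  have "card e = 2" if "e \<in> edges (mixed_cayley A B)" for e
  proof -
    obtain g h where "e = {g, h}" "h - g \<in> A"
      using \<open>e \<in> _\<close> by (auto simp: mixed_cayley_def)
    moreover from this have "g \<noteq> h" using assms(1) by auto
    ultimately show ?thesis by simp
  qed
  moreover have "u \<noteq> v \<and> (v, u) \<notin> arcs (mixed_cayley A B) \<and>
      {u, v} \<notin> edges (mixed_cayley A B)" if "(u, v) \<in> arcs (mixed_cayley A B)" for u v
  proof -
    have uv: "v - u \<in> B" using that by (simp add: mixed_cayley_def)
    hence 1: "u - v \<notin> B" using B[of "v - u"] by simp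
    have 2: "v - u \<notin> A" using uv assms(2) by blast
    hence 3: "u - v \<notin> A" using A[of "u - v"] by auto
    have "u \<noteq> v" using uv assms(1) by auto
    moreover have "{u, v} \<notin> edges (mixed_cayley A B)"
    proof
      assume "{u, v} \<in> edges (mixed_cayley A B)"
      then obtain g h where "{u, v} = {g, h}" and gh: "h - g \<in> A"
        by (auto simp: mixed_cayley_def)
      hence "u = g \<and> v = h \<or> u = h \<and> v = g" by (simp only: doubleton_eq_iff)
      thus False using gh 2 3 by (elim disjE conjE) simp_all
    qed
    moreover have "(v, u) \<notin> arcs (mixed_cayley A B)"
      using 1 by (simp add: mixed_cayley_def)
    ultimately show ?thesis by simp
  qed
  ultimately show ?thesis unfolding wf_mixed_graph_def by blast
qed

lemma group_additive_group: "group (additive_group :: 'g::ab_group_add monoid)"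
proof (rule groupI)
  fix x :: 'g
  show "\<exists>y\<in>carrier additive_group. y \<otimes>\<^bsub>additive_group\<^esub> x = \<one>\<^bsub>additive_group\<^esub>"
    by (intro bexI[of _ "- x"]) (auto simp: additive_group_def)
qed (simp_all add: additive_group_def add.assoc)

lemma minus_mod_4:
  fixes k n r :: nat
  assumes "k < 4 * n" "k mod 4 = r" "0 < r"
  shows "(4 * n - k) mod 4 = 4 - r"
proof -
  have k: "k = 4 * (k div 4) + r" using assms(2) by (metis mult_div_mod_eq)
  have r: "r < 4" using assms(2) by auto
  have "k div 4 < n" using assms(1) k by linarith
  then obtain m where "n = Suc (k div 4 + m)" using less_imp_Suc_add by blast
  hence eq: "4 * n - k = 4 * m + (4 - r)" using k r by linarith
  have "4 - r < 4" using assms(3) by simp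
  thus ?thesis by (simp only: eq mod_mult_self4 mod_less)
qed

lemma neg_units_1_mod_4_eq:
  assumes "n > 0"
  shows "neg_units_1_mod_4 n = {k \<in> totatives (4 * n). [k = 3] (mod 4)}"
proof -
  have m: "1 < 4 * n" using assms by linarith
  have refl: "4 * n - k \<in> totatives (4 * n)" if "k \<in> totatives (4 * n)" for k
  proof -
    have lt: "k < 4 * n" by (rule totatives_less[OF that m])
    moreover have "coprime (4 * n - k) (4 * n)"
    proof (rule coprimeI)
      fix c assume d: "c dvd 4 * n - k" and c: "c dvd 4 * n"
      have "c dvd 4 * n - (4 * n - k)" by (rule dvd_diff_nat[OF c d])
      hence "c dvd k" unfolding diff_diff_cancel[OF less_imp_le[OF lt]] .
      moreover have "coprime k (4 * n)" using that unfolding in_totatives_iff by blast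
      ultimately show "is_unit c" using c by (blast intro: coprime_common_divisor)
    qed
    ultimately show ?thesis by (simp add: totatives_def)
  qed
  show ?thesis
  proof (intro equalityI subsetI)
    fix x assume "x \<in> neg_units_1_mod_4 n"
    then obtain k where k: "k \<in> totatives (4 * n)" "[k = 1] (mod 4)" "x = 4 * n - k"
      by (auto simp: neg_units_1_mod_4_def units_1_mod_4_def)
    have "k < 4 * n" by (rule totatives_less[OF k(1) m])
    hence "[x = 3] (mod 4)"
      using minus_mod_4[of k n 1] k(2,3) by (simp add: cong_def)
    thus "x \<in> {k \<in> totatives (4 * n). [k = 3] (mod 4)}" using refl k by auto
  next
    fix x assume x: "x \<in> {k \<in> totatives (4 * n). [k = 3] (mod 4)}"
    hence "x < 4 * n" using totatives_less[OF _ m] by simp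
    moreover from this have "[4 * n - x = 1] (mod 4)"
      using minus_mod_4[of x n 3] x by (simp add: cong_def)
    ultimately show "x \<in> neg_units_1_mod_4 n"
      using x refl[of x] unfolding neg_units_1_mod_4_def units_1_mod_4_def
      by (intro image_eqI[of _ _ "4 * n - x"]) auto
  qed
qed

lemma zeta_power_eq_iff:
  assumes "t > 0"
  shows "zeta t ^ j = zeta t ^ k \<longleftrightarrow> [j = k] (mod t)"
proof -
  have "zeta t ^ i = exp (2 * of_real pi * \<i> * of_nat i / of_nat t)" for i
    unfolding zeta_def exp_of_nat_mult[symmetric] by (simp add: mult_ac)
  thus ?thesis
    using complex_root_unity_eq[of t j k] assms by (simp add: cong_def)
qed

lemma eta_well_defined:
  assumes "t > 1" and \<sigma>: "\<sigma> \<in> galois_group (cyclotomic_field t) \<rat>"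
  shows "\<exists>!k. k \<in> totatives t \<and> \<sigma> (zeta t) = zeta t ^ k"
proof -
  let ?L = "cyclotomic_field t" and ?z = "zeta t"
  have ops: "x \<otimes>\<^bsub>complex_ring\<^esub> y = x * y" "\<one>\<^bsub>complex_ring\<^esub> = 1" for x y
    by (simp_all add: ring_of_type_algebra_def)
  have z: "?z \<in> ?L" and one: "1 \<in> ?L"
    unfolding cyclotomic_field_def by (auto intro!: generate_field.incl)
  have mult: "x * y \<in> ?L" if "x \<in> ?L" "y \<in> ?L" for x y
    using generate_field.eng_mult[of x complex_ring _ y] that
    by (simp add: cyclotomic_field_def ops)
  have pow: "?z ^ i \<in> ?L" for i
    by (induction i) (auto intro: mult z one)
  have hom: "\<sigma> (x * y) = \<sigma> x * \<sigma> y" if "x \<in> ?L" "y \<in> ?L" for x y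
    using \<sigma> that by (auto simp: galois_group_def ring_iso_def ring_hom_def ops)
  have h1: "\<sigma> 1 = 1" using \<sigma> by (auto simp: galois_group_def)
  have inj: "inj_on \<sigma> ?L"
    using \<sigma> by (auto simp: galois_group_def ring_iso_def bij_betw_def)
  have hpow: "\<sigma> (?z ^ i) = \<sigma> ?z ^ i" for i
    by (induction i) (simp_all add: h1 hom z pow)
  have ord: "?z ^ i = 1 \<longleftrightarrow> t dvd i" for i
    using zeta_power_eq_iff[of t i 0] assms(1) by (simp add: cong_0_iff)
  have ord': "\<sigma> ?z ^ i = 1 \<longleftrightarrow> t dvd i" for i
    using inj_on_eq_iff[OF inj pow[of i] one] by (simp add: hpow h1 ord)
  have "\<sigma> ?z ^ t = 1" by (simp add: ord')
  then obtain k where k: "k < t" "\<sigma> ?z = ?z ^ k"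
    using complex_roots_unity[of t] assms(1)
    unfolding zeta_def exp_of_nat_mult[symmetric] by (auto simp: mult_ac)
  have cop: "coprime k t"
  proof -
    let ?d = "gcd k t"
    have "\<sigma> ?z ^ (t div ?d) = ?z ^ (k * (t div ?d))"
      by (simp add: k power_mult)
    also have "k * (t div ?d) = t * (k div ?d)"
      by (metis div_mult_swap dvd_div_mult gcd_dvd1 gcd_dvd2 mult.commute)
    also have "?z ^ (t * (k div ?d)) = 1" by (simp add: ord)
    finally have "t dvd t div ?d" by (simp add: ord')
    moreover have "t div ?d \<noteq> 0"
      using assms(1) by (simp add: div_eq_0_iff gcd_le2_nat leD)
    ultimately have "t \<le> t div ?d" by (auto dest: dvd_imp_le)
    hence "\<not> 1 < ?d" using div_less_dividend[of ?d t] assms(1) by linarith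
    moreover have "?d \<noteq> 0" using assms(1) by simp
    ultimately have "?d = 1" by linarith
    thus ?thesis by (simp add: coprime_iff_gcd_eq_1)
  qed
  have "k > 0" using cop assms(1) by (cases "k = 0") auto
  hence kt: "k \<in> totatives t" using cop k by (simp add: totatives_def)
  show ?thesis
  proof (intro ex1I[of _ k] conjI kt k)
    fix l assume l: "l \<in> totatives t \<and> \<sigma> ?z = ?z ^ l"
    hence "[l = k] (mod t)" using k zeta_power_eq_iff[of t l k] assms(1) by simp
    moreover have "l < t" using l assms(1) by (auto intro: totatives_less)
    ultimately show "l = k" using k(1) by (simp add: cong_def)
  qed
qed

end

theory Submission
  imports Defs
begin

text \<open>
  Write \<open>\<zeta>\<close> for \<^term>\<open>zeta (4 * n)\<close>, \<open>L\<close> for \<open>\<rat>(\<zeta>)\<close>, and \<open>\<sigma>\<^sub>k\<close> for the automorphism of \<open>L\<close> with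
  \<open>\<sigma>\<^sub>k(\<zeta>) = \<zeta>\<^sup>k\<close>. The adjacency matrix of \<open>Cay(G, A \<union> B)\<close> has the entry \<open>c(v - u)\<close> at \<open>(u, v)\<close>, where \<open>c\<close> is
  \<open>1\<close> on \<open>A\<close>, \<open>\<i>\<close> on \<open>B\<close>, \<open>-\<i>\<close> on \<open>-B\<close> and \<open>0\<close> elsewhere. The characters \<open>\<psi>\<close> of \<open>G\<close> are therefore
  eigenvectors, with the Fourier coefficients \<open>\<lambda>\<^sub>\<psi> = \<Sum>\<^sub>s c(s) \<psi>(s)\<close> as eigenvalues, and they form a basis
  (\<open>charpoly_circulant\<close>). So the splitting field \<open>K\<close> is generated by the \<open>\<lambda>\<^sub>\<psi>\<close>, and it lies in \<open>L\<close>
  because \<open>\<i>\<close> and the values of \<open>\<psi>\<close> are powers of \<open>\<zeta>\<close>.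

  Since \<open>\<sigma>\<^sub>k\<close> sends \<open>\<psi>(s)\<close> to \<open>\<psi>(k s)\<close>, it sends \<open>\<lambda>\<^sub>\<psi>\<close> to \<open>\<Sum>\<^sub>s \<sigma>\<^sub>k(c(s)) \<psi>(k s)\<close>, whereas
  \<open>\<lambda>\<^sub>\<psi> = \<Sum>\<^sub>s c(k s) \<psi>(k s)\<close> by reindexing. The Fourier transform is injective, so \<open>\<sigma>\<^sub>k\<close> fixes every \<open>\<lambda>\<^sub>\<psi>\<close>
  exactly when \<open>\<sigma>\<^sub>k(c(s)) = c(k s)\<close> for all \<open>s\<close> (\<open>eigenvalues_fixed_iff\<close>). As \<open>\<sigma>\<^sub>k\<close> fixes \<open>\<i>\<close> for
  \<open>k \<equiv> 1\<close> and negates it for \<open>k \<equiv> 3\<close> modulo 4, this is the condition that defines \<open>\<H>\<close>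
  (\<open>connection_equivariant_iff\<close>).

  It remains to know the Galois correspondence for the subfields \<open>K\<close> of \<open>L\<close>. If \<open>H\<close> is the set of all \<open>k\<close>
  for which \<open>\<sigma>\<^sub>k\<close> fixes \<open>K\<close> pointwise, then the roots of the minimal polynomial of \<open>\<zeta>\<close> over \<open>K\<close> are exactly the
  \<open>\<zeta>\<^sup>k\<close> with \<open>k \<in> H\<close>, and they are simple. Hence \<open>[L : K] = |H|\<close>
  (\<open>dimension_cyclotomic_over_subfield\<close>), and an element \<open>x = r(\<zeta>)\<close> fixed by \<open>H\<close>, with \<open>r\<close> over \<open>K\<close> reduced
  modulo that polynomial, makes \<open>r - x\<close> vanish at more points than its degree allows, so that \<open>x \<in> K\<close>
  (\<open>fixed_by_conj_stabilizer\<close>). The degree formula follows from the tower law, applied to \<open>K\<close> and to \<open>\<rat>\<close>.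

  That \<open>\<sigma>\<^sub>k\<close> exists for every \<open>k\<close> prime to \<open>4 n\<close> is the irreducibility of the cyclotomic polynomials, in the
  form that every rational polynomial relation satisfied by \<open>\<zeta>\<close> is satisfied by \<open>\<zeta>\<^sup>k\<close>
  (\<open>rational_relation_conjugate\<close>).
\<close>

(* Below, these names denote the type-class notions of prime, polynomial and root multiplicity. *)
hide_const (open) Divisibility.prime Polynomials.degree Polynomials.lead_coeff up_ring.monom up_ring.coeff
  module.smult Coset.order

section \<open>Conjugates of a root of unity over the rationals\<close>

abbreviation int_poly_eval :: "int poly \<Rightarrow> complex \<Rightarrow> complex" where
  "int_poly_eval p z \<equiv> poly (map_poly of_int p) z"

lemma int_poly_eval_add: "int_poly_eval (p + q) z = int_poly_eval p z + int_poly_eval q z"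
proof -
  have "map_poly of_int (p + q) = (map_poly of_int p + map_poly of_int q :: complex poly)"
    by (simp add: poly_eq_iff coeff_map_poly)
  thus ?thesis by simp
qed

lemma int_poly_eval_smult: "int_poly_eval (smult c p) z = of_int c * int_poly_eval p z"
proof -
  have "map_poly of_int (smult c p) =
      (smult (of_int c) (map_poly of_int p) :: complex poly)"
    by (simp add: poly_eq_iff coeff_map_poly)
  thus ?thesis by simp
qed

lemma int_poly_eval_pCons: "int_poly_eval (pCons a p) z = of_int a + z * int_poly_eval p z"
  by (simp add: map_poly_pCons)

lemma int_poly_eval_mult: "int_poly_eval (p * q) z = int_poly_eval p z * int_poly_eval q z"
  by (induction p)
    (simp_all add: int_poly_eval_add int_poly_eval_smult int_poly_eval_pCons algebra_simps)

lemma int_poly_eval_diff: "int_poly_eval (p - q) z = int_poly_eval p z - int_poly_eval q z"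
  using int_poly_eval_add[of "p - q" q z] by simp

lemma int_poly_eval_power: "int_poly_eval (p ^ k) z = int_poly_eval p z ^ k"
  by (induction k) (simp_all add: int_poly_eval_mult)

lemma int_poly_eval_monom: "int_poly_eval (monom c k) z = of_int c * z ^ k"
  by (simp add: map_poly_monom poly_monom)

lemma int_poly_eval_pcompose: "int_poly_eval (p \<circ>\<^sub>p q) z = int_poly_eval p (int_poly_eval q z)"
  by (induction p)
    (simp_all add: pcompose_pCons int_poly_eval_add int_poly_eval_mult int_poly_eval_pCons)

text \<open>A generator of the ideal of integer polynomials that vanish at \<open>z\<close>, hence unique up to sign.\<close>

definition minimal_int_poly :: "int poly \<Rightarrow> complex \<Rightarrow> bool" where
  "minimal_int_poly f z \<longleftrightarrow> f \<noteq> 0 \<and> (\<forall>g. int_poly_eval g z = 0 \<longleftrightarrow> f dvd g)"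

text \<open>Gauss's lemma is what makes the divisibility hold over the integers: a primitive polynomial of least
  degree that vanishes at \<open>z\<close> divides some integer multiple of any other such polynomial by pseudo-division,
  and the constant cancels because contents are multiplicative.\<close>

lemma minimal_int_poly_exists:
  assumes "q \<noteq> 0" "int_poly_eval q z = 0"
  shows "\<exists>f. minimal_int_poly f z"
proof -
  define P where "P = (\<lambda>f. f \<noteq> 0 \<and> int_poly_eval f z = 0)"
  define f0 where "f0 = (ARG_MIN degree f. P f)"
  have "P q" using assms by (simp add: P_def)
  hence f0: "P f0" and min: "\<And>g. P g \<Longrightarrow> degree f0 \<le> degree g"
    unfolding f0_def by (blast intro: arg_min_natI arg_min_nat_le)+
  define f where "f = primitive_part f0"
  have f0_eq: "f0 = smult (content f0) f"
    by (simp add: f_def)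
  have fnz: "f \<noteq> 0" and cf: "content f = 1" and c0: "content f0 \<noteq> 0"
    using f0 by (auto simp: f_def P_def)
  have "int_poly_eval f0 z = of_int (content f0) * int_poly_eval f z"
    using f0_eq int_poly_eval_smult by metis
  hence fz: "int_poly_eval f z = 0" using f0 c0 unfolding P_def by (metis mult_eq_0_iff of_int_eq_0_iff)
  have "f dvd g" if g: "int_poly_eval g z = 0" for g
  proof -
    obtain q r where qr: "pseudo_divmod g f = (q, r)" by fastforce
    define c where "c = coeff f (degree f) ^ (Suc (degree g) - degree f)"
    have eq: "smult c g = f * q + r"
      and deg: "r = 0 \<or> degree r < degree f"
      using pseudo_divmod[OF fnz qr] by (auto simp: c_def)
    have cnz: "c \<noteq> 0" using fnz by (simp add: c_def)
    have "int_poly_eval r z = 0"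
      using arg_cong[OF eq, of "\<lambda>p. int_poly_eval p z"] g fz
      by (simp add: int_poly_eval_add int_poly_eval_mult int_poly_eval_smult)
    moreover have "degree f0 = degree f"
      by (simp add: f_def)
    ultimately have "r = 0" using deg min[of r] by (fastforce simp: P_def)
    hence eq': "smult c g = f * q" using eq by simp
    have "normalize c * content g = content q"
      using arg_cong[OF eq', of content] cf by (simp add: content_mult)
    hence "c dvd content q" by (metis dvd_triv_left normalize_dvd_iff)
    hence "[:c:] dvd q" by (simp add: const_poly_dvd_iff_dvd_content)
    then obtain q' where "q = smult c q'" by (auto elim: dvdE)
    hence "smult c g = smult c (f * q')" using eq' by simp
    hence "g = f * q'" using cnz by (simp add: poly_eq_iff)
    thus ?thesis by simp
  qed
  moreover have "int_poly_eval g z = 0" if "f dvd g" for g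
    using that fz by (auto simp: int_poly_eval_mult)
  ultimately show ?thesis using fnz unfolding minimal_int_poly_def by blast
qed

text \<open>The inner binomial coefficients of a prime exponent are divisible by that prime. The ring need not have
  characteristic \<open>p\<close>, so this is a divisibility and not an equation.\<close>

lemma prime_dvd_power_add:
  fixes a b :: "'a::comm_ring_1"
  assumes "prime p"
  shows "of_nat p dvd (a + b) ^ p - (a ^ p + b ^ p)"
proof -
  have p: "p > 0" using assms by (simp add: prime_gt_0_nat)
  define s where "s = (\<Sum>k\<in>{1..<p}. of_nat (p choose k) * a ^ k * b ^ (p - k))"
  have "{..p} = insert 0 (insert p {1..<p})" using p by auto
  hence "(a + b) ^ p = b ^ p + (a ^ p + s)"
    unfolding binomial_ring using p by (simp add: s_def)
  moreover have "of_nat p dvd s" unfolding s_def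
  proof (intro dvd_sum)
    fix k assume k: "k \<in> {1..<p}"
    have "p dvd p choose k" using k assms by (intro dvd_choose_prime) auto
    hence "(of_nat p :: 'a) dvd of_nat (p choose k)" by (auto elim!: dvdE)
    thus "of_nat p dvd of_nat (p choose k) * a ^ k * b ^ (p - k)" by (simp add: dvd_mult2)
  qed
  ultimately show ?thesis by simp
qed

lemma prime_dvd_power_diff_int:
  fixes a :: int
  assumes "prime p"
  shows "int p dvd a ^ p - a"
proof -
  have nat: "int p dvd int m ^ p - int m" for m
  proof (induction m)
    case 0
    thus ?case using assms by (simp add: prime_gt_0_nat power_0_left)
  next
    case (Suc m)
    have "int p dvd ((int m + 1) ^ p - (int m ^ p + 1 ^ p)) + (int m ^ p - int m)"
      using prime_dvd_power_add[OF assms, of "int m" 1] Suc.IH by (intro dvd_add) simp_all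
    thus ?case by (simp add: algebra_simps)
  qed
  have "int p > 0" using assms by (simp add: prime_gt_0_nat)
  hence "[a = int (nat (a mod int p))] (mod int p)" by (simp add: cong_def)
  hence "[a ^ p - a = int (nat (a mod int p)) ^ p - int (nat (a mod int p))] (mod int p)"
    by (intro cong_diff cong_pow)
  thus ?thesis using nat cong_dvd_iff by blast
qed

text \<open>Over the field with \<open>p\<close> elements, taking a \<open>p\<close>-th power and substituting \<open>x\<^sup>p\<close> for \<open>x\<close> agree, because both are
  additive and multiplicative and agree on constants by Fermat's little theorem.\<close>

lemma int_poly_frobenius:
  fixes g :: "int poly"
  assumes "prime p"
  shows "of_nat p dvd g ^ p - g \<circ>\<^sub>p monom 1 p"
proof (induction g)
  case 0
  thus ?case using assms by (simp add: prime_gt_0_nat power_0_left)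
next
  case (pCons a g)
  let ?x = "monom 1 1 :: int poly" and ?X = "monom 1 p :: int poly"
  have eq: "pCons a g = [:a:] + ?x * g"
    by (simp add: monom_Suc)
  have 1: "of_nat p dvd (pCons a g) ^ p - ([:a:] ^ p + (?x * g) ^ p)"
    unfolding eq by (rule prime_dvd_power_add[OF assms])
  have "[:a:] ^ p - [:a:] = [:a ^ p - a:]" by (simp add: poly_const_pow)
  hence 2: "of_nat p dvd [:a:] ^ p - [:a:]"
    using prime_dvd_power_diff_int[OF assms, of a] by (simp add: of_nat_poly)
  have 3: "of_nat p dvd ?X * (g ^ p - g \<circ>\<^sub>p ?X)"
    using pCons.IH by simp
  have "(pCons a g) ^ p - pCons a g \<circ>\<^sub>p ?X =
     ((pCons a g) ^ p - ([:a:] ^ p + (?x * g) ^ p)) + ([:a:] ^ p - [:a:]) + ?X * (g ^ p - g \<circ>\<^sub>p ?X)"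
    by (simp add: pcompose_pCons power_mult_distrib monom_power algebra_simps)
  thus ?case using 1 2 3 by (simp only: dvd_add)
qed

text \<open>Put \<open>w = z\<^sup>p\<close> and \<open>x\<^sup>t - 1 = f g\<close>. If \<open>f(w)\<close> were nonzero, then \<open>g(w) = 0\<close>, and differentiating the
  factorisation at \<open>w\<close> gives \<open>t w\<^sup>t\<^sup>-\<^sup>1 = f(w) g'(w)\<close>. But \<open>f(w)\<close> is \<open>p\<close> times an integer polynomial in \<open>z\<close>, as
  \<open>f(z\<^sup>p) \<equiv> f(z)\<^sup>p = 0\<close> modulo \<open>p\<close>. So \<open>t = p k(z)\<close> for some integer polynomial \<open>k\<close>; reducing \<open>k\<close> modulo \<open>f\<close>
  turns this into an identity of polynomials, and \<open>p\<close> divides \<open>t\<close>. This is Dedekind's argument with the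
  separability of \<open>x\<^sup>t - 1\<close> modulo \<open>p\<close> replaced by an explicit derivative.\<close>

lemma minimal_int_poly_root_power_prime:
  assumes f: "minimal_int_poly f z" and z: "z ^ t = 1" and p: "prime p" "\<not> p dvd t"
  shows "int_poly_eval f (z ^ p) = 0"
proof (rule ccontr)
  assume nz: "int_poly_eval f (z ^ p) \<noteq> 0"
  have t: "t > 0" using p(2) by (cases t) auto
  have f0: "f \<noteq> 0" and f_dvd: "\<And>g. int_poly_eval g z = 0 \<Longrightarrow> f dvd g"
    and fz: "int_poly_eval f z = 0"
    using f by (auto simp: minimal_int_poly_def)
  define w where "w = z ^ p"
  have wt: "w ^ t = 1" unfolding w_def by (metis z mult.commute power_mult power_one)
  let ?m = "monom 1 t - 1 :: int poly"
  have "f dvd ?m" using z by (intro f_dvd) (simp add: int_poly_eval_diff int_poly_eval_monom)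
  then obtain g where g: "?m = f * g" by (elim dvdE)
  have "int_poly_eval f w * int_poly_eval g w = int_poly_eval ?m w"
    by (simp add: g int_poly_eval_mult)
  also have "\<dots> = 0" using wt by (simp add: int_poly_eval_diff int_poly_eval_monom)
  finally have gw: "int_poly_eval g w = 0" using nz by (simp add: w_def)
  have "monom (int t) (t - 1) = f * pderiv g + g * pderiv f"
    using arg_cong[OF g, of pderiv] by (simp add: pderiv_diff pderiv_monom pderiv_mult)
  from arg_cong[OF this, of "\<lambda>p. int_poly_eval p w"]
  have "of_nat t * w ^ (t - 1) = int_poly_eval f w * int_poly_eval (pderiv g) w"
    by (simp add: int_poly_eval_monom int_poly_eval_add int_poly_eval_mult gw)
  hence "of_nat t * w ^ t = w * int_poly_eval f w * int_poly_eval (pderiv g) w"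
    using t by (cases t) (simp_all add: mult_ac)
  hence t_eq: "of_nat t = w * int_poly_eval f w * int_poly_eval (pderiv g) w"
    by (simp add: wt)
  from int_poly_frobenius[OF p(1), of f] obtain h
    where h: "f ^ p - f \<circ>\<^sub>p monom 1 p = of_nat p * h" by (elim dvdE)
  have p0: "p > 0" using p by (simp add: prime_gt_0_nat)
  from arg_cong[OF h, of "\<lambda>p. int_poly_eval p z"]
  have "- int_poly_eval f w = of_nat p * int_poly_eval h z"
    using p0 by (simp add: int_poly_eval_diff int_poly_eval_power int_poly_eval_pcompose
        int_poly_eval_monom int_poly_eval_smult fz w_def of_nat_poly power_0_left)
  hence fw: "int_poly_eval f w = - (of_nat p * int_poly_eval h z)"
    by (metis minus_minus)
  define k where "k = - (monom 1 p * h * (pderiv g \<circ>\<^sub>p monom 1 p))"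
  have k: "of_nat t = of_nat p * int_poly_eval k z"
    unfolding t_eq fw using int_poly_eval_diff[of 0]
    by (simp add: k_def int_poly_eval_mult int_poly_eval_pcompose int_poly_eval_monom w_def)
  obtain q r where qr: "pseudo_divmod k f = (q, r)" by fastforce
  define c where "c = lead_coeff f ^ (Suc (degree k) - degree f)"
  have "lead_coeff f * lead_coeff g = lead_coeff ?m" by (simp add: g lead_coeff_mult)
  also have "degree ?m = t"
    using t degree_add_eq_left[of "- 1" "monom 1 t :: int poly"] by (simp add: degree_monom_eq)
  hence "lead_coeff ?m = 1" using t by simp
  finally have "is_unit (lead_coeff f)" by (metis dvd_triv_left)
  hence c_unit: "is_unit c" unfolding c_def by (metis dvd_power_same power_one)
  have eq: "smult c k = f * q + r"
    and deg: "r = 0 \<or> degree r < degree f"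
    using pseudo_divmod[OF f0 qr] by (auto simp: c_def)
  have fdeg: "degree f > 0"
  proof (rule ccontr)
    assume "\<not> ?thesis"
    then obtain a where a: "f = [:a:]" by (auto elim: degree_eq_zeroE)
    thus False using fz f0 by (simp add: map_poly_pCons)
  qed
  from arg_cong[OF eq, of "\<lambda>p. int_poly_eval p z"]
  have "of_int c * int_poly_eval k z = int_poly_eval r z"
    by (simp add: int_poly_eval_smult int_poly_eval_add int_poly_eval_mult fz)
  hence "of_int (c * int t) = of_nat p * int_poly_eval r z" using k by simp
  hence "f dvd smult (int p) r - [:c * int t:]"
    by (intro f_dvd) (simp add: int_poly_eval_diff int_poly_eval_smult int_poly_eval_pCons)
  (* The degree is below that of f, so divisibility by f leaves only the zero polynomial. *)
  moreover have "degree (smult (int p) r - [:c * int t:]) < degree f"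
    using deg fdeg by (intro degree_diff_less) auto
  ultimately have "smult (int p) r - [:c * int t:] = 0"
    by (meson dvd_imp_degree_le not_less)
  hence "coeff (smult (int p) r - [:c * int t:]) 0 = 0" by (simp only: coeff_0)
  hence "c * int t = int p * coeff r 0" by simp
  hence "int p dvd c * int t" by (metis dvd_triv_left)
  hence "int p dvd int t" using dvd_mult_unit_iff'[OF c_unit] by blast
  thus False using p(2) by simp
qed

text \<open>A minimal polynomial is irreducible: it is also minimal for each of its other roots.\<close>

lemma minimal_int_poly_power_prime:
  assumes f: "minimal_int_poly f z" and z: "z ^ t = 1" and p: "prime p" "\<not> p dvd t"
  shows "minimal_int_poly f (z ^ p)"
proof -
  have fw: "int_poly_eval f (z ^ p) = 0"
    by (rule minimal_int_poly_root_power_prime[OF assms])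
  have f0: "f \<noteq> 0" and fz: "\<And>g. int_poly_eval g z = 0 \<longleftrightarrow> f dvd g"
    using f by (auto simp: minimal_int_poly_def)
  obtain f2 where f2: "minimal_int_poly f2 (z ^ p)"
    using minimal_int_poly_exists[OF f0 fw] by blast
  have f2w: "\<And>g. int_poly_eval g (z ^ p) = 0 \<longleftrightarrow> f2 dvd g"
    using f2 by (auto simp: minimal_int_poly_def)
  then obtain q where q: "f = f2 * q" using fw by (auto elim: dvdE)
  have "int_poly_eval f2 z * int_poly_eval q z = 0"
    using fz[of f] by (simp add: q int_poly_eval_mult)
  hence "f dvd f2 \<or> f dvd q" by (simp add: fz)
  moreover have "\<not> f dvd q"
  proof
    assume "f dvd q"
    then obtain c where "q = f * c" by (elim dvdE)
    hence "q * (f2 * c) = q * 1" using q by (simp add: mult_ac)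
    moreover have "q \<noteq> 0" using f0 q by auto
    ultimately have "f2 * c = 1" by (metis mult_cancel_left)
    moreover have "int_poly_eval (f2 * c) (z ^ p) = 0" using f2w by simp
    ultimately show False by simp
  qed
  ultimately have "f dvd f2" by blast
  moreover have "f2 dvd f" using q by simp
  ultimately have "\<And>g. f2 dvd g \<longleftrightarrow> f dvd g" by (blast intro: dvd_trans)
  thus ?thesis using f0 f2w by (simp add: minimal_int_poly_def)
qed

lemma minimal_int_poly_power_coprime:
  assumes "minimal_int_poly f z" "z ^ t = 1" "coprime k t"
  shows "minimal_int_poly f (z ^ k)"
  using assms(3)
proof (induction k rule: prime_divisors_induct)
  case zero
  thus ?case using assms by simp
next
  case (unit k)
  thus ?case using assms by simp
next
  case (factor p k)
  hence "coprime k t" "coprime p t" by simp_all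
  moreover have "\<not> p dvd t" using factor.hyps \<open>coprime p t\<close>
    by (metis coprime_common_divisor dvd_refl not_prime_unit)
  moreover have "(z ^ k) ^ t = 1" using assms(2) by (metis mult.commute power_mult power_one)
  ultimately have "minimal_int_poly f ((z ^ k) ^ p)"
    using factor minimal_int_poly_power_prime[of f "z ^ k" t p] by blast
  thus ?case by (simp add: mult.commute flip: power_mult)
qed

lemma zeta_power_self: "t > 0 \<Longrightarrow> zeta t ^ t = 1"
  using zeta_power_eq_iff[of t t 0] by (simp add: cong_def)

lemma rational_poly_clear_denominators:
  fixes g :: "complex poly"
  assumes "\<And>i. coeff g i \<in> \<rat>"
  shows "\<exists>c q. c \<noteq> 0 \<and> smult (of_int c) g = map_poly of_int q"
  using assms
proof (induction g)
  case 0
  show ?case by (intro exI[of _ 1] exI[of _ 0]) simp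
next
  case (pCons a g)
  have "coeff g i \<in> \<rat>" for i using pCons.prems[of "Suc i"] by simp
  then obtain c q where c: "c \<noteq> 0" "smult (of_int c) g = map_poly of_int q"
    using pCons.IH by blast
  have "a \<in> \<rat>" using pCons.prems[of 0] by simp
  then obtain u v :: int where uv: "v \<noteq> 0" "a = of_int u / of_int v"
    by (metis Rats_cases' less_irrefl)
  show ?case
  proof (intro exI conjI)
    show "c * v \<noteq> 0" using c uv by simp
    have "smult (of_int (c * v)) (pCons a g) =
        pCons (of_int (c * u)) (smult (of_int v) (smult (of_int c) g))"
      using uv by (simp add: mult.commute)
    also have "\<dots> = map_poly of_int (pCons (c * u) (smult v q))"
      unfolding c(2) by (simp add: poly_eq_iff coeff_map_poly coeff_pCons split: nat.splits)
    finally show "smult (of_int (c * v)) (pCons a g) =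
        map_poly of_int (pCons (c * u) (smult v q))" .
  qed
qed

text \<open>This is the irreducibility of the \<open>t\<close>-th cyclotomic polynomial over \<open>\<rat>\<close>: all primitive \<open>t\<close>-th roots of unity
  have the same minimal polynomial.\<close>

theorem rational_relation_conjugate:
  assumes t: "t > 0" and k: "coprime k t" and g: "\<And>i. coeff g i \<in> \<rat>"
    and z: "poly g (zeta t) = 0"
  shows "poly g (zeta t ^ k) = 0"
proof -
  obtain f where f: "minimal_int_poly f (zeta t)"
  proof -
    have "int_poly_eval (monom 1 t - 1) (zeta t) = 0"
      using t zeta_power_self[of t] by (simp add: int_poly_eval_diff int_poly_eval_monom)
    moreover have "monom 1 t - 1 \<noteq> (0 :: int poly)"
      using t by (auto simp: poly_eq_iff dest!: spec[of _ t])
    ultimately show ?thesis using minimal_int_poly_exists that by blast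
  qed
  hence fk: "minimal_int_poly f (zeta t ^ k)"
    using k t zeta_power_self minimal_int_poly_power_coprime by blast
  obtain c q where c: "c \<noteq> 0" "smult (of_int c) g = map_poly of_int q"
    using rational_poly_clear_denominators[OF g] by blast
  hence "int_poly_eval q z = of_int c * poly g z" for z
    by (simp flip: c)
  hence "int_poly_eval q z = 0 \<longleftrightarrow> poly g z = 0" for z using c(1) by simp
  thus ?thesis using f fk z unfolding minimal_int_poly_def by metis
qed

section \<open>Polynomials over subfields of the complex numbers\<close>

lemma complex_ring_simps [simp]:
  "carrier complex_ring = UNIV" "x \<otimes>\<^bsub>complex_ring\<^esub> y = x * y" "x \<oplus>\<^bsub>complex_ring\<^esub> y = x + y"
  "\<one>\<^bsub>complex_ring\<^esub> = 1" "\<zero>\<^bsub>complex_ring\<^esub> = 0"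
  by (simp_all add: ring_of_type_algebra_def)

lemma field_complex_ring: "Ring.field complex_ring"
  by (rule field_from_type_algebra)

interpretation CR: cring complex_ring
  by (rule cring_from_type_algebra)

lemma complex_ring_a_inv [simp]: "\<ominus>\<^bsub>complex_ring\<^esub> x = - x"
  using CR.add.inv_equality[of "- x" x] by (simp add: a_inv_def)

lemma complex_ring_m_inv [simp]: "x \<noteq> 0 \<Longrightarrow> inv\<^bsub>complex_ring\<^esub> x = inverse x"
  using CR.comm_inv_char[of x "inverse x"] by simp

lemma complex_subfield_iff:
  "subfield K complex_ring \<longleftrightarrow> 1 \<in> K \<and> (\<forall>x\<in>K. \<forall>y\<in>K. x - y \<in> K \<and> x * y \<in> K) \<and> (\<forall>x\<in>K. inverse x \<in> K)"
proof
  assume K: "subfield K complex_ring"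
  note sr = subringE[OF subfieldE(1)[OF K], simplified]
  have "x - y \<in> K" if "x \<in> K" "y \<in> K" for x y
    using sr(7)[OF that(1) sr(5)[OF that(2)]] by simp
  moreover have "inverse x \<in> K" if "x \<in> K" for x
    using CR.subfield_m_inv(1)[OF K, of x] that sr(2) by (cases "x = 0") auto
  ultimately show "1 \<in> K \<and> (\<forall>x\<in>K. \<forall>y\<in>K. x - y \<in> K \<and> x * y \<in> K) \<and> (\<forall>x\<in>K. inverse x \<in> K)"
    using sr(3,6) by simp
next
  assume K: "1 \<in> K \<and> (\<forall>x\<in>K. \<forall>y\<in>K. x - y \<in> K \<and> x * y \<in> K) \<and> (\<forall>x\<in>K. inverse x \<in> K)"
  hence "0 \<in> K" by (metis cancel_comm_monoid_add_class.diff_cancel)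
  hence neg: "- x \<in> K" if "x \<in> K" for x using K that by (metis diff_0)
  hence "x + y \<in> K" if "x \<in> K" "y \<in> K" for x y using K that by (metis diff_minus_eq_add)
  hence "subring K complex_ring"
    using K neg by (intro CR.subringI) auto
  thus "subfield K complex_ring"
    using K by (intro field.subfieldI'[OF field_complex_ring]) auto
qed

context
  fixes K :: "complex set"
  assumes K: "subfield K complex_ring"
begin

lemma complex_subfield_closed:
  shows "0 \<in> K" "1 \<in> K"
    and "x \<in> K \<Longrightarrow> - x \<in> K"
    and "x \<in> K \<Longrightarrow> y \<in> K \<Longrightarrow> x + y \<in> K"
    and "x \<in> K \<Longrightarrow> y \<in> K \<Longrightarrow> x - y \<in> K"
    and "x \<in> K \<Longrightarrow> y \<in> K \<Longrightarrow> x * y \<in> K"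
    and "x \<in> K \<Longrightarrow> inverse x \<in> K"
proof -
  note sr = subringE[OF subfieldE(1)[OF K], simplified]
  show "0 \<in> K" "1 \<in> K" "x \<in> K \<Longrightarrow> - x \<in> K" "x \<in> K \<Longrightarrow> y \<in> K \<Longrightarrow> x + y \<in> K"
    using sr(2,3,5,7) by simp_all
  show "x \<in> K \<Longrightarrow> y \<in> K \<Longrightarrow> x - y \<in> K" "x \<in> K \<Longrightarrow> y \<in> K \<Longrightarrow> x * y \<in> K"
    "x \<in> K \<Longrightarrow> inverse x \<in> K"
    using K unfolding complex_subfield_iff by simp_all
qed

lemma complex_subfield_divide: "x \<in> K \<Longrightarrow> y \<in> K \<Longrightarrow> x / y \<in> K"
  unfolding divide_inverse by (intro complex_subfield_closed)

lemma complex_subfield_power: "x \<in> K \<Longrightarrow> x ^ k \<in> K"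
  by (induction k) (auto intro: complex_subfield_closed)

lemma complex_subfield_sum: "(\<And>i. i \<in> I \<Longrightarrow> f i \<in> K) \<Longrightarrow> sum f I \<in> K"
  by (induction I rule: infinite_finite_induct) (auto intro: complex_subfield_closed)

lemma complex_subfield_of_nat: "of_nat k \<in> K"
  by (induction k) (auto intro: complex_subfield_closed)

lemma complex_subfield_of_int: "of_int k \<in> K"
  by (cases k rule: int_cases2) (auto intro: complex_subfield_closed complex_subfield_of_nat)

lemma Rats_subset_complex_subfield: "\<rat> \<subseteq> K"
proof
  fix x :: complex assume "x \<in> \<rat>"
  then obtain a b where "x = of_int a / of_int b" by (metis Rats_cases')
  thus "x \<in> K" by (auto intro: complex_subfield_divide complex_subfield_of_int)
qed

end

lemma subfield_Rats_complex: "subfield (\<rat> :: complex set) complex_ring"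
  by (simp add: complex_subfield_iff)

definition polys_over :: "complex set \<Rightarrow> complex poly set" where
  "polys_over K = {p. \<forall>i. coeff p i \<in> K}"

lemma polys_over_mono: "K \<subseteq> K' \<Longrightarrow> polys_over K \<subseteq> polys_over K'"
  by (auto simp: polys_over_def)

lemma polys_over_pCons_iff [simp]: "pCons a p \<in> polys_over K \<longleftrightarrow> a \<in> K \<and> p \<in> polys_over K"
  unfolding polys_over_def by (auto simp: coeff_pCons split: nat.splits)

context
  fixes K :: "complex set"
  assumes K: "subfield K complex_ring"
begin

lemma polys_over_closed:
  shows "0 \<in> polys_over K" "1 \<in> polys_over K"
    and "p \<in> polys_over K \<Longrightarrow> q \<in> polys_over K \<Longrightarrow> p + q \<in> polys_over K"
    and "p \<in> polys_over K \<Longrightarrow> q \<in> polys_over K \<Longrightarrow> p - q \<in> polys_over K"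
    and "p \<in> polys_over K \<Longrightarrow> q \<in> polys_over K \<Longrightarrow> p * q \<in> polys_over K"
    and "c \<in> K \<Longrightarrow> monom c k \<in> polys_over K"
    and "c \<in> K \<Longrightarrow> p \<in> polys_over K \<Longrightarrow> smult c p \<in> polys_over K"
  by (auto simp: polys_over_def coeff_mult coeff_1 of_bool_def
      intro!: complex_subfield_closed[OF K] complex_subfield_sum[OF K])

lemma polys_over_pcompose_monom:
  "p \<in> polys_over K \<Longrightarrow> p \<circ>\<^sub>p monom 1 k \<in> polys_over K"
proof (induction p)
  case 0
  thus ?case by (simp add: polys_over_closed)
next
  case (pCons a p)
  thus ?case
    using complex_subfield_closed[OF K]
    by (auto simp: pcompose_pCons intro!: polys_over_closed)
qed

text \<open>The quotient and the remainder have their coefficients in \<open>K\<close>. Division of complex polynomials does not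
  say this, so the division algorithm is repeated coefficient by coefficient.\<close>

lemma poly_division_over_subfield:
  assumes q: "q \<in> polys_over K" "q \<noteq> 0" and p: "p \<in> polys_over K"
  obtains a r where "a \<in> polys_over K" "r \<in> polys_over K" "p = q * a + r"
    "r = 0 \<or> degree r < degree q"
proof -
  have "\<exists>a r. a \<in> polys_over K \<and> r \<in> polys_over K \<and> p = q * a + r \<and> (r = 0 \<or> degree r < degree q)"
    using p
  proof (induction p)
    case 0
    show ?case by (intro exI[of _ 0]) (simp add: polys_over_closed)
  next
    case (pCons c p)
    then obtain a r where ar: "a \<in> polys_over K" "r \<in> polys_over K" "p = q * a + r"
      "r = 0 \<or> degree r < degree q" by auto
    (* The shifted remainder x * r + c may reach the degree of q; subtracting b * q removes that term. *)
    define b where "b = coeff (pCons c r) (degree q) / lead_coeff q"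
    have cr: "pCons c r \<in> polys_over K" using ar pCons.prems by simp
    have bK: "b \<in> K" using cr q unfolding b_def polys_over_def
      by (intro complex_subfield_divide[OF K]) auto
    define r' where "r' = pCons c r - smult b q"
    have "pCons c p = q * pCons b a + r'"
      by (simp add: ar(3) r'_def)
    moreover have "r' \<in> polys_over K" unfolding r'_def
      using bK q cr by (intro polys_over_closed)
    moreover have "r' = 0 \<or> degree r' < degree q"
    proof -
      have "degree (pCons c r) \<le> degree q" using ar(4) by (auto simp: degree_pCons_eq_if)
      hence "degree r' \<le> degree q" unfolding r'_def
        using degree_smult_le[of b q] by (intro degree_diff_le) auto
      moreover have "coeff r' (degree q) = 0" using q(2) by (simp add: r'_def b_def)
      ultimately show ?thesis
        by (metis le_neq_implies_less leading_coeff_0_iff)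
    qed
    ultimately show ?case using bK ar(1) by (intro exI[of _ "pCons b a"] exI[of _ r']) auto
  qed
  thus thesis using that by blast
qed

end

definition minimal_poly_over :: "complex set \<Rightarrow> complex poly \<Rightarrow> complex \<Rightarrow> bool" where
  "minimal_poly_over K f z \<longleftrightarrow>
     f \<noteq> 0 \<and> f \<in> polys_over K \<and> poly f z = 0 \<and> (\<forall>g\<in>polys_over K. poly g z = 0 \<longrightarrow> f dvd g)"

lemma minimal_poly_over_exists:
  assumes K: "subfield K complex_ring" and "q \<in> polys_over K" "q \<noteq> 0" "poly q z = 0"
  shows "\<exists>f. minimal_poly_over K f z"
proof -
  define P where "P = (\<lambda>f. f \<noteq> 0 \<and> f \<in> polys_over K \<and> poly f z = 0)"
  define f where "f = (ARG_MIN degree f. P f)"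
  have "P q" using assms by (simp add: P_def)
  hence f: "P f" and min: "\<And>g. P g \<Longrightarrow> degree f \<le> degree g"
    unfolding f_def by (blast intro: arg_min_natI arg_min_nat_le)+
  have "f dvd g" if g: "g \<in> polys_over K" "poly g z = 0" for g
  proof -
    obtain a r where ar: "r \<in> polys_over K" "g = f * a + r" "r = 0 \<or> degree r < degree f"
      using poly_division_over_subfield[OF K _ _ g(1), of f] f unfolding P_def by blast
    have "poly r z = 0" using g(2) f unfolding ar(2) P_def by simp
    hence "r = 0" using min[of r] ar unfolding P_def by fastforce
    thus ?thesis using ar(2) by simp
  qed
  thus ?thesis using f unfolding P_def minimal_poly_over_def by blast
qed

lemma minimal_poly_over_degree_pos:
  assumes "minimal_poly_over K f z"
  shows "degree f > 0"
proof (rule ccontr)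
  assume "\<not> ?thesis"
  then obtain a where f: "f = [:a:]" by (auto elim: degree_eq_zeroE)
  have "f \<noteq> 0" "poly f z = 0" using assms unfolding minimal_poly_over_def by blast+
  thus False using f by simp
qed

text \<open>\<open>K[z]\<close> is a field when \<open>z\<close> is algebraic over \<open>K\<close>. For \<open>g\<close> of smaller degree than the minimal polynomial \<open>f\<close>,
  write \<open>f = g q + r\<close>; then \<open>1/g(z) = -q(z)/r(z)\<close>, and \<open>r\<close> has smaller degree than \<open>g\<close>. The descent can only
  stop at a constant \<open>g\<close>, since \<open>r(z) = 0\<close> forces \<open>f = g q\<close> with \<open>q(z) = 0\<close>.\<close>

lemma inverse_as_poly_value:
  assumes K: "subfield K complex_ring" and f: "minimal_poly_over K f z"
    and g: "g \<in> polys_over K" "poly g z \<noteq> 0"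
  shows "\<exists>u\<in>polys_over K. inverse (poly g z) = poly u z"
proof -
  have fK: "f \<in> polys_over K" "poly f z = 0" "f \<noteq> 0"
    and fd: "\<And>q. q \<in> polys_over K \<Longrightarrow> poly q z = 0 \<Longrightarrow> f dvd q"
    using f by (auto simp: minimal_poly_over_def)
  have reduced: "\<exists>u\<in>polys_over K. inverse (poly g z) = poly u z"
    if "g \<in> polys_over K" "poly g z \<noteq> 0" "degree g < degree f" for g
    using that
  proof (induction "degree g" arbitrary: g rule: less_induct)
    case less
    have g0: "g \<noteq> 0" using less.prems by auto
    obtain q r where qr: "q \<in> polys_over K" "r \<in> polys_over K" "f = g * q + r"
        "r = 0 \<or> degree r < degree g"
      using poly_division_over_subfield[OF K less.prems(1) g0 fK(1)] by blast
    have eq: "poly g z * poly q z = - poly r z"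
      using fK(2) unfolding qr(3) by (simp add: eq_neg_iff_add_eq_0)
    show ?case
    proof (cases "poly r z = 0")
      case False
      hence r: "r \<noteq> 0" "degree r < degree g" using qr(4) by auto
      then obtain u where u: "u \<in> polys_over K" "inverse (poly r z) = poly u z"
        using less.hyps[of r] qr(2) False less.prems(3) by auto
      have "inverse (poly g z) = poly (0 - q * u) z"
        using False less.prems(2) eq by (simp add: field_simps flip: u(2))
      thus ?thesis using u qr(1) polys_over_closed[OF K] by blast
    next
      case True
      have "r = 0"
        using fd[OF qr(2) True] qr(4) less.prems(3) dvd_imp_degree_le[of f r] by fastforce
      have "poly q z = 0" using eq True less.prems(2) by simp
      hence "f dvd q" using fd qr by blast
      hence "degree f \<le> degree q" using qr(3) fK(3) \<open>r = 0\<close> by (intro dvd_imp_degree_le) auto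
      moreover have "degree f = degree g + degree q"
        using qr(3) fK(3) \<open>r = 0\<close> by (auto simp: degree_mult_eq)
      ultimately have "degree g = 0" by simp
      then obtain c where c: "g = [:c:]" by (auto elim: degree_eq_zeroE)
      have "[:inverse c:] \<in> polys_over K"
        using less.prems(1) complex_subfield_closed[OF K] unfolding c by (simp add: polys_over_closed[OF K])
      thus ?thesis by (intro bexI[of _ "[:inverse c:]"]) (simp_all add: c)
    qed
  qed
  obtain a r where ar: "r \<in> polys_over K" "g = f * a + r" "r = 0 \<or> degree r < degree f"
    using poly_division_over_subfield[OF K fK(1,3) g(1)] by blast
  hence "poly g z = poly r z" using fK(2) by simp
  thus ?thesis using reduced[of r] ar g(2) minimal_poly_over_degree_pos[OF f] by fastforce
qed

section \<open>Conjugation on a cyclotomic field\<close>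

lemma zeta_in_cyclotomic_field: "zeta t \<in> cyclotomic_field t"
  unfolding cyclotomic_field_def by (intro generate_field.incl) auto

lemma subfield_cyclotomic_field: "subfield (cyclotomic_field t) complex_ring"
  unfolding cyclotomic_field_def by (intro field.generate_field_is_subfield[OF field_complex_ring]) auto

lemma zeta_power_in: "zeta t ^ j \<in> cyclotomic_field t"
  by (intro complex_subfield_power subfield_cyclotomic_field zeta_in_cyclotomic_field)

lemma poly_value_closed:
  assumes "subfield L complex_ring" "p \<in> polys_over L" "z \<in> L"
  shows "poly p z \<in> L"
  using assms(2)
  by (induction p) (auto intro!: complex_subfield_closed[OF assms(1)] assms(3))

lemma monom_minus_1_vanishes_zeta:
  assumes "t > 0" and K: "subfield K complex_ring"
  shows "monom 1 t - 1 \<in> polys_over K" "monom 1 t - (1 :: complex poly) \<noteq> 0"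
    "poly (monom 1 t - 1) (zeta t) = 0"
proof -
  show "monom 1 t - 1 \<in> polys_over K"
    by (intro polys_over_closed complex_subfield_closed K)
  show "monom 1 t - (1 :: complex poly) \<noteq> 0"
    using assms(1) by (auto simp: poly_eq_iff dest!: spec[of _ t])
  show "poly (monom 1 t - 1) (zeta t) = 0"
    using zeta_power_self[OF assms(1)] by (simp add: poly_monom)
qed

lemma minimal_poly_zeta_exists:
  assumes "t > 0" "subfield K complex_ring"
  shows "\<exists>f. minimal_poly_over K f (zeta t)"
  using minimal_poly_over_exists monom_minus_1_vanishes_zeta[OF assms] assms by blast

lemma cyclotomic_field_eq:
  assumes t: "t > 0"
  shows "cyclotomic_field t = (\<lambda>g. poly g (zeta t)) ` polys_over \<rat>"
proof
  let ?Q = "(\<lambda>g. poly g (zeta t)) ` polys_over \<rat>"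
  note cl = polys_over_closed[OF subfield_Rats_complex]
  obtain f where f: "minimal_poly_over \<rat> f (zeta t)"
    using minimal_poly_zeta_exists[OF t subfield_Rats_complex] by blast
  have "subfield ?Q complex_ring"
    unfolding complex_subfield_iff
  proof (intro conjI ballI)
    show "1 \<in> ?Q" using cl(2) by (intro image_eqI[of _ _ 1]) auto
    fix x y assume "x \<in> ?Q" "y \<in> ?Q"
    then obtain p q where "p \<in> polys_over \<rat>" "q \<in> polys_over \<rat>" "x = poly p (zeta t)" "y = poly q (zeta t)"
      by blast
    thus "x - y \<in> ?Q" "x * y \<in> ?Q"
      using cl(4,5)[of p q] by (metis (no_types, lifting) image_eqI poly_diff poly_mult)+
  next
    fix x assume "x \<in> ?Q"
    then obtain p where p: "p \<in> polys_over \<rat>" "x = poly p (zeta t)" by blast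
    show "inverse x \<in> ?Q"
    proof (cases "x = 0")
      case True
      thus ?thesis using cl(1) by (intro image_eqI[of _ _ 0]) auto
    next
      case False
      thus ?thesis using inverse_as_poly_value[OF subfield_Rats_complex f p(1)] p(2) by blast
    qed
  qed
  moreover have "\<rat> \<union> {zeta t} \<subseteq> ?Q"
  proof
    fix x assume "x \<in> \<rat> \<union> {zeta t}"
    moreover have "x \<in> \<rat> \<Longrightarrow> x \<in> ?Q"
      using cl(1) by (intro image_eqI[of _ _ "[:x:]"]) auto
    moreover have "zeta t \<in> ?Q"
      using cl(1) by (intro image_eqI[of _ _ "[:0, 1:]"]) auto
    ultimately show "x \<in> ?Q" by blast
  qed
  ultimately show "cyclotomic_field t \<subseteq> ?Q"
    unfolding cyclotomic_field_def by (intro field.generate_field_min_subfield1[OF field_complex_ring]) auto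
next
  have "polys_over \<rat> \<subseteq> polys_over (cyclotomic_field t)"
    by (intro polys_over_mono Rats_subset_complex_subfield subfield_cyclotomic_field)
  thus "(\<lambda>g. poly g (zeta t)) ` polys_over \<rat> \<subseteq> cyclotomic_field t"
    using poly_value_closed[OF subfield_cyclotomic_field _ zeta_in_cyclotomic_field] by blast
qed

text \<open>On the cyclotomic field this is the automorphism with \<open>\<zeta> \<mapsto> \<zeta>\<^sup>k\<close>. The chosen polynomial representative is
  irrelevant there, by \<open>rational_relation_conjugate\<close>; elsewhere the value is arbitrary.\<close>

definition cyclotomic_conj :: "nat \<Rightarrow> nat \<Rightarrow> complex \<Rightarrow> complex" where
  "cyclotomic_conj t k x = poly (SOME g. g \<in> polys_over \<rat> \<and> poly g (zeta t) = x) (zeta t ^ k)"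

lemma cyclotomic_conj_poly:
  assumes t: "t > 0" and k: "coprime k t" and g: "g \<in> polys_over \<rat>"
  shows "cyclotomic_conj t k (poly g (zeta t)) = poly g (zeta t ^ k)"
proof -
  define h where "h = (SOME h. h \<in> polys_over \<rat> \<and> poly h (zeta t) = poly g (zeta t))"
  have h: "h \<in> polys_over \<rat> \<and> poly h (zeta t) = poly g (zeta t)"
    unfolding h_def by (rule someI[of _ g]) (simp add: g)
  have "h - g \<in> polys_over \<rat>"
    using h g by (intro polys_over_closed subfield_Rats_complex) auto
  hence "poly (h - g) (zeta t ^ k) = 0"
    using h by (intro rational_relation_conjugate[OF t k]) (auto simp: polys_over_def)
  thus ?thesis by (simp add: cyclotomic_conj_def h_def)
qed

lemma cyclotomic_fieldE:
  assumes "t > 0" "x \<in> cyclotomic_field t"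
  obtains g where "g \<in> polys_over \<rat>" "x = poly g (zeta t)"
  using assms cyclotomic_field_eq by auto

context
  fixes t k :: nat
  assumes t: "t > 0" and k: "coprime k t"
begin

lemma cyclotomic_conj_add:
  assumes "x \<in> cyclotomic_field t" "y \<in> cyclotomic_field t"
  shows "cyclotomic_conj t k (x + y) = cyclotomic_conj t k x + cyclotomic_conj t k y"
proof -
  obtain p q where "p \<in> polys_over \<rat>" "x = poly p (zeta t)" "q \<in> polys_over \<rat>" "y = poly q (zeta t)"
    using assms cyclotomic_fieldE[OF t] by metis
  moreover from this have "p + q \<in> polys_over \<rat>"
    by (intro polys_over_closed subfield_Rats_complex)
  ultimately show ?thesis
    using cyclotomic_conj_poly[OF t k] by (metis poly_add)
qed

lemma cyclotomic_conj_mult: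
  assumes "x \<in> cyclotomic_field t" "y \<in> cyclotomic_field t"
  shows "cyclotomic_conj t k (x * y) = cyclotomic_conj t k x * cyclotomic_conj t k y"
proof -
  obtain p q where "p \<in> polys_over \<rat>" "x = poly p (zeta t)" "q \<in> polys_over \<rat>" "y = poly q (zeta t)"
    using assms cyclotomic_fieldE[OF t] by metis
  moreover from this have "p * q \<in> polys_over \<rat>"
    by (intro polys_over_closed subfield_Rats_complex)
  ultimately show ?thesis
    using cyclotomic_conj_poly[OF t k] by (metis poly_mult)
qed

lemma cyclotomic_conj_Rats: "q \<in> \<rat> \<Longrightarrow> cyclotomic_conj t k q = q"
  using cyclotomic_conj_poly[OF t k, of "[:q:]"] polys_over_closed(1)[OF subfield_Rats_complex] by simp

lemma cyclotomic_conj_zeta_power: "cyclotomic_conj t k (zeta t ^ i) = zeta t ^ (k * i)"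
  using cyclotomic_conj_poly[OF t k, of "monom 1 i"] polys_over_closed(6)[OF subfield_Rats_complex]
  by (simp add: poly_monom flip: power_mult)

lemma cyclotomic_conj_in: "x \<in> cyclotomic_field t \<Longrightarrow> cyclotomic_conj t k x \<in> cyclotomic_field t"
proof -
  assume "x \<in> cyclotomic_field t"
  then obtain g where g: "g \<in> polys_over \<rat>" "x = poly g (zeta t)"
    using cyclotomic_fieldE[OF t] by metis
  have "g \<in> polys_over (cyclotomic_field t)"
    using g(1) polys_over_mono[OF Rats_subset_complex_subfield[OF subfield_cyclotomic_field]] by blast
  thus ?thesis unfolding g(2) cyclotomic_conj_poly[OF t k g(1)]
    by (intro poly_value_closed[OF subfield_cyclotomic_field]
       complex_subfield_power[OF subfield_cyclotomic_field] zeta_in_cyclotomic_field)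
qed

lemma cyclotomic_conj_uminus:
  assumes "x \<in> cyclotomic_field t"
  shows "cyclotomic_conj t k (- x) = - cyclotomic_conj t k x"
  using cyclotomic_conj_add[OF assms, of "- x"] assms complex_subfield_closed(3)[OF subfield_cyclotomic_field]
    cyclotomic_conj_Rats[of 0] by (simp add: eq_neg_iff_add_eq_0 add.commute)

lemma cyclotomic_conj_diff:
  assumes "x \<in> cyclotomic_field t" "y \<in> cyclotomic_field t"
  shows "cyclotomic_conj t k (x - y) = cyclotomic_conj t k x - cyclotomic_conj t k y"
  using cyclotomic_conj_add[of x "- y"] cyclotomic_conj_uminus[of y] assms
    complex_subfield_closed(3)[OF subfield_cyclotomic_field] by simp

lemma cyclotomic_conj_sum:
  assumes "\<And>i. i \<in> I \<Longrightarrow> f i \<in> cyclotomic_field t"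
  shows "cyclotomic_conj t k (sum f I) = (\<Sum>i\<in>I. cyclotomic_conj t k (f i))"
  using assms
  by (induction I rule: infinite_finite_induct)
    (simp_all add: cyclotomic_conj_Rats cyclotomic_conj_add complex_subfield_sum[OF subfield_cyclotomic_field])

end

lemma cyclotomic_conj_comp:
  assumes t: "t > 0" and "coprime j t" "coprime k t" and x: "x \<in> cyclotomic_field t"
  shows "cyclotomic_conj t j (cyclotomic_conj t k x) = cyclotomic_conj t (j * k) x"
proof -
  obtain g where g: "g \<in> polys_over \<rat>" "x = poly g (zeta t)"
    using cyclotomic_fieldE[OF t x] by metis
  have g': "g \<circ>\<^sub>p monom 1 k \<in> polys_over \<rat>"
    using polys_over_pcompose_monom[OF subfield_Rats_complex g(1)] .
  have "cyclotomic_conj t k x = poly (g \<circ>\<^sub>p monom 1 k) (zeta t)"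
    using assms by (simp add: g cyclotomic_conj_poly poly_pcompose poly_monom)
  hence "cyclotomic_conj t j (cyclotomic_conj t k x) = poly (g \<circ>\<^sub>p monom 1 k) (zeta t ^ j)"
    using assms g' by (simp add: cyclotomic_conj_poly)
  also have "\<dots> = cyclotomic_conj t (j * k) x"
    using assms g by (simp add: cyclotomic_conj_poly poly_pcompose poly_monom flip: power_mult)
  finally show ?thesis .
qed

lemma cyclotomic_conj_cong_1:
  assumes t: "t > 0" and k: "[k = 1] (mod t)" and x: "x \<in> cyclotomic_field t"
  shows "cyclotomic_conj t k x = x"
proof -
  have k': "coprime k t" using k by (metis cong_imp_coprime cong_sym coprime_1_left)
  obtain g where g: "g \<in> polys_over \<rat>" "x = poly g (zeta t)"
    using cyclotomic_fieldE[OF t x] by metis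
  have "zeta t ^ k = zeta t" using zeta_power_eq_iff[OF t, of k 1] k by simp
  thus ?thesis using cyclotomic_conj_poly[OF t k' g(1)] by (simp add: g(2))
qed

text \<open>The inverse of \<open>\<zeta> \<mapsto> \<zeta>\<^sup>k\<close> is \<open>\<zeta> \<mapsto> \<zeta>\<^sup>j\<close> for any \<open>j\<close> inverse to \<open>k\<close> modulo \<open>t\<close>. Together with the next lemma this says
  that \<^const>\<open>eta\<close> is a bijection from the Galois group to the units, with the restricted
  \<^const>\<open>cyclotomic_conj\<close> as its inverse.\<close>

lemma cyclotomic_conj_in_galois_group:
  assumes t: "t > 1" and k: "k \<in> totatives t"
  defines "\<sigma> \<equiv> restrict (cyclotomic_conj t k) (cyclotomic_field t)"
  shows "\<sigma> \<in> galois_group (cyclotomic_field t) \<rat>" "eta t \<sigma> = k"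
proof -
  let ?L = "cyclotomic_field t"
  note L = complex_subfield_closed[OF subfield_cyclotomic_field[of t]]
  have t0: "t > 0" and cop: "coprime k t" using t k by (auto simp: totatives_def)
  obtain j where j: "[k * j = 1] (mod t)"
    using cop cong_solve_coprime_nat by (metis One_nat_def)
  hence copj: "coprime j t" by (metis cong_imp_coprime cong_sym coprime_1_left coprime_mult_left_iff)
  have "bij_betw (cyclotomic_conj t k) ?L ?L"
  proof (rule bij_betw_byWitness[where f' = "cyclotomic_conj t j"])
    show "\<forall>x\<in>?L. cyclotomic_conj t j (cyclotomic_conj t k x) = x"
      "\<forall>x\<in>?L. cyclotomic_conj t k (cyclotomic_conj t j x) = x"
      using j by (simp_all add: cyclotomic_conj_comp t0 cop copj cyclotomic_conj_cong_1 mult.commute)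
    show "cyclotomic_conj t k ` ?L \<subseteq> ?L" "cyclotomic_conj t j ` ?L \<subseteq> ?L"
      using cyclotomic_conj_in[OF t0] cop copj by blast+
  qed
  hence "bij_betw \<sigma> ?L ?L" by (simp add: \<sigma>_def cong: bij_betw_cong)
  thus gal: "\<sigma> \<in> galois_group ?L \<rat>"
    using L(2) L(4,6)
      cyclotomic_conj_in[OF t0 cop] Rats_subset_complex_subfield[OF subfield_cyclotomic_field, of t]
    by (auto simp: galois_group_def ring_iso_def ring_hom_def \<sigma>_def cyclotomic_conj_add[OF t0 cop]
        cyclotomic_conj_mult[OF t0 cop] cyclotomic_conj_Rats[OF t0 cop])
  have "\<sigma> (zeta t) = zeta t ^ k"
    using cyclotomic_conj_zeta_power[OF t0 cop, of 1] zeta_in_cyclotomic_field by (simp add: \<sigma>_def)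
  thus "eta t \<sigma> = k"
    unfolding eta_def using eta_well_defined[OF t gal] k by (intro the1_equality) auto
qed

lemma galois_group_cyclotomicD:
  assumes t: "t > 1" and \<sigma>: "\<sigma> \<in> galois_group (cyclotomic_field t) \<rat>"
  shows "eta t \<sigma> \<in> totatives t"
    and "x \<in> cyclotomic_field t \<Longrightarrow> \<sigma> x = cyclotomic_conj t (eta t \<sigma>) x"
proof -
  let ?L = "cyclotomic_field t" and ?k = "eta t \<sigma>"
  have k: "?k \<in> totatives t \<and> \<sigma> (zeta t) = zeta t ^ ?k"
    unfolding eta_def by (rule theI'[OF eta_well_defined[OF assms]])
  thus "?k \<in> totatives t" by blast
  assume "x \<in> ?L"
  then obtain g where g: "g \<in> polys_over \<rat>" "x = poly g (zeta t)"
    using cyclotomic_fieldE t by (metis less_trans zero_less_one)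
  have hom: "\<sigma> (x * y) = \<sigma> x * \<sigma> y" "\<sigma> (x + y) = \<sigma> x + \<sigma> y" if "x \<in> ?L" "y \<in> ?L" for x y
    using \<sigma> that by (auto simp: galois_group_def ring_iso_def ring_hom_def)
  have rat: "\<sigma> q = q" if "q \<in> \<rat>" for q
    using \<sigma> that by (auto simp: galois_group_def)
  have Q: "\<rat> \<subseteq> ?L" by (intro Rats_subset_complex_subfield subfield_cyclotomic_field)
  have "\<sigma> (poly g (zeta t)) = poly g (\<sigma> (zeta t))"
    using g(1)
  proof (induction g)
    case 0
    thus ?case by (simp add: rat)
  next
    case (pCons a g)
    have "poly g (zeta t) \<in> ?L" using pCons.prems polys_over_mono[OF Q]
      by (intro poly_value_closed subfield_cyclotomic_field zeta_in_cyclotomic_field) auto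
    thus ?case using pCons Q zeta_in_cyclotomic_field[of t]
      by (auto simp: hom rat complex_subfield_closed(6)[OF subfield_cyclotomic_field])
  qed
  thus "\<sigma> x = cyclotomic_conj t ?k x"
    using cyclotomic_conj_poly[of t ?k g] k g t by (simp add: totatives_def)
qed

text \<open>From here on the Galois group enters only through the maps \<^const>\<open>cyclotomic_conj\<close>.\<close>

lemma fixed_field_cyclotomic:
  assumes t: "t > 1" and H: "H \<subseteq> totatives t"
  shows "fixed_field (cyclotomic_field t) {\<sigma> \<in> galois_group (cyclotomic_field t) \<rat>. eta t \<sigma> \<in> H} =
    {x \<in> cyclotomic_field t. \<forall>k\<in>H. cyclotomic_conj t k x = x}"
  unfolding fixed_field_def
  using galois_group_cyclotomicD[OF t] cyclotomic_conj_in_galois_group[OF t] H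
  by (fastforce simp: subset_iff)

section \<open>The Galois correspondence for subfields of a cyclotomic field\<close>

lemma poly_root_dvd: "f dvd g \<Longrightarrow> poly f z = 0 \<Longrightarrow> poly g z = 0"
  by (elim dvdE) simp

definition conj_stabilizer :: "nat \<Rightarrow> complex set \<Rightarrow> nat set" where
  "conj_stabilizer t K = {k \<in> totatives t. \<forall>x\<in>K. cyclotomic_conj t k x = x}"

text \<open>If \<open>\<zeta>\<^sup>j\<close> has order \<open>s\<close> and is a root of the minimal polynomial of \<open>\<zeta>\<close>, then its own minimal polynomial is the same up to
  a constant and divides \<open>x\<^sup>s - 1\<close>. So \<open>\<zeta>\<^sup>s = 1\<close>, and \<open>s\<close> is a multiple of \<open>t\<close>.\<close>

lemma zeta_power_root_coprime:
  assumes t: "t > 0" and f: "minimal_poly_over \<rat> f (zeta t)" and j: "poly f (zeta t ^ j) = 0"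
  shows "coprime j t"
proof -
  note Q = subfield_Rats_complex
  define s where "s = t div gcd j t"
  have fQ: "f \<in> polys_over \<rat>" "poly f (zeta t) = 0" "f \<noteq> 0"
    and fd: "\<And>q. q \<in> polys_over \<rat> \<Longrightarrow> poly q (zeta t) = 0 \<Longrightarrow> f dvd q"
    using f by (auto simp: minimal_poly_over_def)
  obtain f' where f': "minimal_poly_over \<rat> f' (zeta t ^ j)"
    using minimal_poly_over_exists[OF Q fQ(1,3) j] by blast
  hence f'Q: "f' \<in> polys_over \<rat>" "f' \<noteq> 0" and f'd: "\<And>q. q \<in> polys_over \<rat> \<Longrightarrow> poly q (zeta t ^ j) = 0 \<Longrightarrow> f' dvd q"
    by (auto simp: minimal_poly_over_def)
  obtain e r where er: "e \<in> polys_over \<rat>" "r \<in> polys_over \<rat>" "f = f' * e + r" "r = 0 \<or> degree r < degree f'"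
    using poly_division_over_subfield[OF Q f'Q fQ(1)] by blast
  have "f' dvd f' * e + r" using f'd[OF fQ(1) j] er(3) by simp
  hence "f' dvd r" by (metis dvd_add_right_iff dvd_triv_left)
  hence "r = 0" using er(4) by (meson dvd_imp_degree_le not_less)
  hence fe: "f = f' * e" using er by simp
  have "poly f' (zeta t) = 0"
  proof (rule ccontr)
    assume "poly f' (zeta t) \<noteq> 0"
    hence "f dvd e" using fQ(2) fe er(1) by (intro fd) auto
    moreover have "e \<noteq> 0" using fe fQ(3) by auto
    ultimately have "degree f \<le> degree e" by (intro dvd_imp_degree_le)
    moreover have "degree f = degree f' + degree e"
      unfolding fe using \<open>e \<noteq> 0\<close> f'Q(2) by (intro degree_mult_eq)
    ultimately show False using minimal_poly_over_degree_pos[OF f'] by linarith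
  qed
  moreover have "f' dvd monom 1 s - 1"
  proof (rule f'd)
    show "monom 1 s - 1 \<in> polys_over \<rat>"
      by (intro polys_over_closed Q complex_subfield_closed)
    have "j * s = t * (j div gcd j t)"
      unfolding s_def by (metis div_mult_swap dvd_div_mult gcd_dvd1 gcd_dvd2 mult.commute)
    hence "(zeta t ^ j) ^ s = 1"
      using zeta_power_self[OF t] by (simp add: power_mult flip: power_mult[of _ j s])
    thus "poly (monom 1 s - 1) (zeta t ^ j) = 0" by (simp add: poly_monom)
  qed
  ultimately have "poly (monom 1 s - 1) (zeta t) = 0" by (metis poly_root_dvd)
  hence "zeta t ^ s = zeta t ^ 0" by (simp add: poly_monom)
  hence "t dvd s" using zeta_power_eq_iff[OF t, of s 0] by (simp add: cong_0_iff)
  moreover have "s > 0" using t unfolding s_def by (simp add: div_greater_zero_iff gcd_le2_nat)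
  ultimately have "t \<le> t div gcd j t" unfolding s_def by (auto dest: dvd_imp_le)
  hence "\<not> 1 < gcd j t" using div_less_dividend[of "gcd j t" t] t by linarith
  moreover have "gcd j t \<noteq> 0" using t by simp
  ultimately have "gcd j t = 1" by linarith
  thus ?thesis by (simp add: coprime_iff_gcd_eq_1)
qed

text \<open>A double root would be a common root of \<open>x\<^sup>t - 1\<close> and of its derivative \<open>t x\<^sup>t\<^sup>-\<^sup>1\<close>, which vanishes at most at \<open>0\<close>.\<close>

lemma rsquarefree_dvd_monom_minus_1:
  assumes t: "t > 0" and f: "f dvd monom 1 t - (1 :: complex poly)"
  shows "rsquarefree f"
  unfolding rsquarefree_roots
proof (intro allI notI)
  fix a assume a: "poly f a = 0 \<and> poly (pderiv f) a = 0"
  obtain g where g: "monom 1 t - 1 = f * g" using f by (elim dvdE)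
  have "pderiv (monom 1 t - 1 :: complex poly) = monom (of_nat t) (t - 1)"
    by (simp add: pderiv_diff pderiv_monom)
  hence "poly (monom (of_nat t) (t - 1)) a = 0"
    using a unfolding g pderiv_mult by (metis add_0 mult_zero_left mult_zero_right poly_add poly_mult)
  hence "a = 0" using t by (simp add: poly_monom)
  moreover have "a ^ t = 1" using arg_cong[OF g, of "\<lambda>p. poly p a"] a by (simp add: poly_monom)
  ultimately show False using t by (simp add: power_0_left)
qed

lemma card_roots_rsquarefree:
  assumes "rsquarefree (f :: complex poly)"
  shows "card {z. poly f z = 0} = degree f"
proof -
  have f0: "f \<noteq> 0" using assms by (simp add: rsquarefree_def)
  have "degree f = degree (\<Prod>z | poly f z = 0. [:-z, 1:])"
    by (subst complex_poly_decompose_rsquarefree[OF assms, symmetric]) (simp add: f0)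
  also have "\<dots> = (\<Sum>z | poly f z = 0. degree [:-z, 1:])"
    by (intro degree_prod_eq_sum_degree) auto
  finally show ?thesis by simp
qed

text \<open>The factor \<open>c\<close> makes the induction on the coefficient list go through; the case of interest is \<open>c = 1\<close>.\<close>

lemma combine_powers:
  assumes "length ks \<le> d"
  shows "CR.combine ks (map (\<lambda>i. c * z ^ i) [0..<d]) = c * poly (Poly ks) z"
  using assms
proof (induction ks arbitrary: c d)
  case Nil
  thus ?case by simp
next
  case (Cons a ks)
  then obtain e where d: "d = Suc e" by (cases d) auto
  have "map (\<lambda>i. c * z ^ i) [0..<d] = c # map (\<lambda>i. (c * z) * z ^ i) [0..<e]"
    unfolding d upt_conv_Cons[OF zero_less_Suc] map_Suc_upt[symmetric] by (simp add: mult_ac)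
  thus ?case using Cons.IH[of e "c * z"] Cons.prems d by (simp add: algebra_simps)
qed

context
  fixes t :: nat and K :: "complex set"
  assumes t: "t > 0" and K: "subfield K complex_ring" and KL: "K \<subseteq> cyclotomic_field t"
begin

lemma cyclotomic_conj_poly_over_fixed:
  assumes k: "k \<in> conj_stabilizer t K" and p: "p \<in> polys_over K"
  shows "cyclotomic_conj t k (poly p (zeta t)) = poly p (zeta t ^ k)"
proof -
  have cop: "coprime k t" using k by (auto simp: conj_stabilizer_def totatives_def)
  note L = subfield_cyclotomic_field[of t]
  show ?thesis using p
  proof (induction p)
    case 0
    show ?case by (simp add: cyclotomic_conj_Rats[OF t cop])
  next
    case (pCons a p)
    have "poly p (zeta t) \<in> cyclotomic_field t"
      using pCons.prems polys_over_mono[OF KL]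
      by (intro poly_value_closed L zeta_in_cyclotomic_field) auto
    moreover have "cyclotomic_conj t k a = a" using k pCons.prems by (auto simp: conj_stabilizer_def)
    moreover have "cyclotomic_conj t k (zeta t) = zeta t ^ k"
      using cyclotomic_conj_zeta_power[OF t cop, of 1] by simp
    moreover have "a \<in> cyclotomic_field t" using pCons.prems KL by auto
    ultimately show ?case using pCons zeta_in_cyclotomic_field[of t]
      by (simp add: cyclotomic_conj_add[OF t cop] cyclotomic_conj_mult[OF t cop]
          complex_subfield_closed(6)[OF L])
  qed
qed

text \<open>For the inclusion of the roots, let \<open>f(\<zeta>\<^sup>k) = 0\<close> and \<open>y = g(\<zeta>) \<in> K\<close> with \<open>g\<close> over \<open>\<rat>\<close>. The polynomial \<open>g - y\<close> over
  \<open>K\<close> vanishes at \<open>\<zeta>\<close>, hence is divisible by \<open>f\<close> and vanishes at \<open>\<zeta>\<^sup>k\<close>: so \<open>\<sigma>\<^sub>k(y) = g(\<zeta>\<^sup>k) = y\<close>. Conversely, a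
  conjugation that fixes the coefficients of \<open>f\<close> permutes its roots.\<close>

lemma minimal_poly_zeta_roots:
  assumes f: "minimal_poly_over K f (zeta t)"
  shows "{z. poly f z = 0} = (\<lambda>k. zeta t ^ k) ` conj_stabilizer t K"
    and "card {z. poly f z = 0} = degree f"
    and "card (conj_stabilizer t K) = degree f"
proof -
  note Q = subfield_Rats_complex
  have QK: "\<rat> \<subseteq> K" by (rule Rats_subset_complex_subfield[OF K])
  have fK: "f \<in> polys_over K" "poly f (zeta t) = 0" "f \<noteq> 0"
    and fd: "\<And>q. q \<in> polys_over K \<Longrightarrow> poly q (zeta t) = 0 \<Longrightarrow> f dvd q"
    using f by (auto simp: minimal_poly_over_def)
  have f_dvd: "f dvd monom 1 t - 1"
    using monom_minus_1_vanishes_zeta[OF t K] by (intro fd)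
  show roots: "{z. poly f z = 0} = (\<lambda>k. zeta t ^ k) ` conj_stabilizer t K"
  proof (intro equalityI subsetI)
    fix z assume "z \<in> {z. poly f z = 0}"
    hence z: "poly f z = 0" by simp
    hence "poly (monom 1 t - 1) z = 0" by (rule poly_root_dvd[OF f_dvd])
    hence "z ^ t = 1" by (simp add: poly_monom)
    then obtain j where j: "j < t" "z = zeta t ^ j"
      using complex_roots_unity[of t] t
      unfolding zeta_def exp_of_nat_mult[symmetric] by (auto simp: mult_ac)
    obtain fQ where fQ: "minimal_poly_over \<rat> fQ (zeta t)"
      using minimal_poly_zeta_exists[OF t Q] by blast
    have "f dvd fQ" using fQ polys_over_mono[OF QK] by (intro fd) (auto simp: minimal_poly_over_def)
    hence "poly fQ z = 0" using z by (rule poly_root_dvd)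
    hence cop: "coprime j t" using zeta_power_root_coprime[OF t fQ] j by blast
    obtain k where k: "k \<in> totatives t" "zeta t ^ k = z"
    proof (cases "t = 1")
      case True
      thus ?thesis using that[of 1] zeta_power_self[of 1] j by (simp add: totatives_def)
    next
      case False
      hence "j > 0" using cop t by (cases "j = 0") auto
      thus ?thesis using that[of j] j cop by (simp add: totatives_def)
    qed
    have "cyclotomic_conj t k y = y" if y: "y \<in> K" for y
    proof -
      obtain g where g: "g \<in> polys_over \<rat>" "y = poly g (zeta t)"
        using cyclotomic_fieldE[OF t] y KL by blast
      have "g - [:y:] \<in> polys_over K"
        using g(1) y polys_over_mono[OF QK] polys_over_closed(1)[OF K]
        by (intro polys_over_closed K) auto
      hence "f dvd g - [:y:]" using g(2) by (intro fd) auto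
      hence "poly (g - [:y:]) z = 0" using z by (rule poly_root_dvd)
      thus ?thesis
        using cyclotomic_conj_poly[OF t _ g(1)] k g by (simp add: totatives_def)
    qed
    hence "k \<in> conj_stabilizer t K" using k by (simp add: conj_stabilizer_def)
    thus "z \<in> (\<lambda>k. zeta t ^ k) ` conj_stabilizer t K" using k(2) by blast
  next
    fix z assume "z \<in> (\<lambda>k. zeta t ^ k) ` conj_stabilizer t K"
    then obtain k where k: "k \<in> conj_stabilizer t K" "z = zeta t ^ k" by blast
    have "coprime k t" using k(1) by (simp add: conj_stabilizer_def totatives_def)
    thus "z \<in> {z. poly f z = 0}"
      using cyclotomic_conj_poly_over_fixed[OF k(1) fK(1)] fK(2) k(2)
        cyclotomic_conj_Rats[OF t, of k 0] by simp
  qed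
  show card_roots: "card {z. poly f z = 0} = degree f"
    by (intro card_roots_rsquarefree rsquarefree_dvd_monom_minus_1[OF t f_dvd])
  have "inj_on (\<lambda>k. zeta t ^ k) (conj_stabilizer t K)"
  proof (rule inj_onI)
    fix i j assume ij: "i \<in> conj_stabilizer t K" "j \<in> conj_stabilizer t K" "zeta t ^ i = zeta t ^ j"
    hence "[i = j] (mod t)" using zeta_power_eq_iff[OF t] by blast
    moreover have "0 < i" "i \<le> t" "0 < j" "j \<le> t"
      using ij by (auto simp: conj_stabilizer_def totatives_def)
    ultimately show "i = j"
      by (metis cong_def le_neq_implies_less mod_less mod_self neq0_conv)
  qed
  thus "card (conj_stabilizer t K) = degree f"
    using card_roots by (simp add: roots card_image)
qed

lemma cyclotomic_field_reduced_poly: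
  assumes f: "minimal_poly_over K f (zeta t)" and x: "x \<in> cyclotomic_field t"
  obtains r where "r \<in> polys_over K" "degree r < degree f" "x = poly r (zeta t)"
proof -
  have QK: "\<rat> \<subseteq> K" by (rule Rats_subset_complex_subfield[OF K])
  have fK: "f \<in> polys_over K" "poly f (zeta t) = 0" "f \<noteq> 0"
    using f by (auto simp: minimal_poly_over_def)
  obtain g where g: "g \<in> polys_over \<rat>" "x = poly g (zeta t)"
    using cyclotomic_fieldE[OF t x] by metis
  have "g \<in> polys_over K" using g polys_over_mono[OF QK] by blast
  then obtain a r where ar: "r \<in> polys_over K" "g = f * a + r" "r = 0 \<or> degree r < degree f"
    using poly_division_over_subfield[OF K fK(1,3)] by blast
  show thesis
  proof (rule that[OF ar(1)])
    show "degree r < degree f" using ar(3) minimal_poly_over_degree_pos[OF f] by auto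
    show "x = poly r (zeta t)" using g(2) ar(2) fK(2) by simp
  qed
qed

text \<open>Write a fixed element as \<open>x = r(\<zeta>)\<close> with \<open>r\<close> over \<open>K\<close> of smaller degree than the minimal polynomial \<open>f\<close>. Then
  \<open>r - x\<close> vanishes at all \<open>deg f\<close> conjugates of \<open>\<zeta>\<close> over \<open>K\<close>, so it is zero and \<open>x\<close> is the constant coefficient of \<open>r\<close>.\<close>

theorem fixed_by_conj_stabilizer:
  "{x \<in> cyclotomic_field t. \<forall>k\<in>conj_stabilizer t K. cyclotomic_conj t k x = x} = K"
proof (intro equalityI subsetI)
  fix x assume "x \<in> {x \<in> cyclotomic_field t. \<forall>k\<in>conj_stabilizer t K. cyclotomic_conj t k x = x}"
  hence x: "x \<in> cyclotomic_field t" "\<And>k. k \<in> conj_stabilizer t K \<Longrightarrow> cyclotomic_conj t k x = x"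
    by auto
  obtain f where f: "minimal_poly_over K f (zeta t)"
    using minimal_poly_zeta_exists[OF t K] by blast
  obtain r where r: "r \<in> polys_over K" "degree r < degree f" "x = poly r (zeta t)"
    using cyclotomic_field_reduced_poly[OF f x(1)] by metis
  have "r - [:x:] = 0"
  proof (rule ccontr)
    assume nz: "r - [:x:] \<noteq> 0"
    have sub: "{z. poly f z = 0} \<subseteq> {z. poly (r - [:x:]) z = 0}"
      unfolding minimal_poly_zeta_roots(1)[OF f]
      using cyclotomic_conj_poly_over_fixed[OF _ r(1)] x(2) r(3) by auto
    have "degree f = card {z. poly f z = 0}"
      using minimal_poly_zeta_roots(2)[OF f] by simp
    also have "\<dots> \<le> card {z. poly (r - [:x:]) z = 0}"
      by (intro card_mono poly_roots_finite nz sub)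
    also have "\<dots> \<le> degree (r - [:x:])"
      using nz by (rule card_poly_roots_bound)
    also have "\<dots> < degree f" using r(2) by (intro degree_diff_less) auto
    finally show False by simp
  qed
  hence "coeff r 0 = x" by (metis coeff_pCons_0 eq_iff_diff_eq_0)
  thus "x \<in> K" using r(1) by (auto simp: polys_over_def)
next
  fix x assume "x \<in> K"
  thus "x \<in> {x \<in> cyclotomic_field t. \<forall>k\<in>conj_stabilizer t K. cyclotomic_conj t k x = x}"
    using KL by (auto simp: conj_stabilizer_def)
qed

text \<open>The powers of \<open>\<zeta>\<close> below the degree of its minimal polynomial over \<open>K\<close> are a basis.\<close>

theorem dimension_cyclotomic_over_subfield:
  "CR.dimension (card (conj_stabilizer t K)) K (cyclotomic_field t)"
proof -
  obtain f where f: "minimal_poly_over K f (zeta t)"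
    using minimal_poly_zeta_exists[OF t K] by blast
  define d where "d = degree f"
  define Us where "Us = map (\<lambda>i. 1 * zeta t ^ i) [0..<d]"
  have len: "length Us = d" by (simp add: Us_def)
  have Us: "set Us \<subseteq> carrier complex_ring" by simp
  have comb: "CR.combine ks Us = poly (Poly ks) (zeta t)" if "length ks \<le> d" for ks
    unfolding Us_def using combine_powers[OF that, of 1] by simp
  have Poly_in: "Poly ks \<in> polys_over K" if "set ks \<subseteq> K" for ks
    using that complex_subfield_closed(1)[OF K] by (auto simp: polys_over_def coeff_Poly_eq nth_default_def subset_iff)
  have "CR.independent K Us"
  proof (rule CR.trivial_combine_imp_independent[OF K Us])
    fix ks assume ks: "set ks \<subseteq> K" "CR.combine ks Us = \<zero>\<^bsub>complex_ring\<^esub>"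
    let ?ks = "take (length Us) ks"
    have sub: "set ?ks \<subseteq> K" using ks(1) set_take_subset by fast
    have "poly (Poly ?ks) (zeta t) = CR.combine ?ks Us"
      by (rule comb[symmetric]) (simp add: len)
    also have "\<dots> = 0" using ks(2) by (simp add: CR.combine_take)
    finally have "f dvd Poly ?ks"
      using f Poly_in[OF sub] unfolding minimal_poly_over_def by blast
    moreover have "degree (Poly ?ks) < d"
    proof -
      have "d > 0" using minimal_poly_over_degree_pos[OF f] by (simp add: d_def)
      moreover have "degree (Poly ?ks) \<le> d - 1"
        by (intro degree_le) (auto simp: coeff_Poly_eq nth_default_def len)
      ultimately show ?thesis by linarith
    qed
    ultimately have "Poly ?ks = 0" unfolding d_def by (meson dvd_imp_degree_le not_less)
    hence "\<exists>n. ?ks = replicate n 0" by (simp only: Poly_eq_0)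
    thus "set ?ks \<subseteq> {\<zero>\<^bsub>complex_ring\<^esub>}" by (metis complex_ring_simps(5) set_replicate_conv_if empty_subsetI order_refl)
  qed
  moreover have "CR.Span K Us = cyclotomic_field t"
  proof (intro equalityI subsetI)
    fix x assume "x \<in> CR.Span K Us"
    then obtain ks where ks: "set ks \<subseteq> K" "length ks = length Us" "x = CR.combine ks Us"
      using CR.Span_mem_iff_length_version[OF K Us] by blast
    have "x = poly (Poly ks) (zeta t)" using ks comb len by simp
    thus "x \<in> cyclotomic_field t"
      using Poly_in[OF ks(1)] polys_over_mono[OF KL]
        poly_value_closed[OF subfield_cyclotomic_field _ zeta_in_cyclotomic_field] by blast
  next
    fix x assume "x \<in> cyclotomic_field t"
    then obtain r where r: "r \<in> polys_over K" "degree r < degree f" "x = poly r (zeta t)"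
      using cyclotomic_field_reduced_poly[OF f] by metis
    have "length (coeffs r) \<le> d" using r(2) by (cases "r = 0") (auto simp: d_def length_coeffs)
    hence "x = CR.combine (coeffs r) Us" using comb r(3) by simp
    moreover have "set (coeffs r) \<subseteq> K"
      using r(1) by (auto simp: polys_over_def coeffs_def)
    ultimately show "x \<in> CR.Span K Us"
      using CR.Span_eq_combine_set[OF K Us] by blast
  qed
  ultimately have "CR.dimension (length Us) K (cyclotomic_field t)"
    using CR.dimension_independent by metis
  thus ?thesis using minimal_poly_zeta_roots(3)[OF f] len by (simp add: d_def)
qed

end

lemma conj_stabilizer_Rats: "t > 0 \<Longrightarrow> conj_stabilizer t \<rat> = totatives t"
  by (auto simp: conj_stabilizer_def totatives_def cyclotomic_conj_Rats)

text \<open>The tower law for \<open>\<rat> \<subseteq> K \<subseteq> \<rat>(\<zeta>)\<close>. The degree of \<open>\<rat>(\<zeta>)\<close> over \<open>\<rat>\<close> is the case \<open>K = \<rat>\<close> of the preceding theorem,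
  since every conjugation fixes the rationals.\<close>

theorem dim_intermediate_field:
  assumes t: "t > 0" and K: "subfield K complex_ring" and KL: "K \<subseteq> cyclotomic_field t"
  shows "CR.dim \<rat> K * card (conj_stabilizer t K) = totient t"
proof -
  note Q = subfield_Rats_complex
  have QL: "\<rat> \<subseteq> cyclotomic_field t"
    by (intro Rats_subset_complex_subfield subfield_cyclotomic_field)
  have L_Q: "CR.dimension (totient t) \<rat> (cyclotomic_field t)"
    using dimension_cyclotomic_over_subfield[OF t Q QL]
    by (simp add: conj_stabilizer_Rats[OF t] totient_def)
  have "subalgebra \<rat> K complex_ring"
  proof (intro subalgebra.intro subalgebra_axioms.intro)
    show "subgroup K (add_monoid complex_ring)"
      using subring.axioms(1)[OF subfieldE(1)[OF K]] .
    show "k \<otimes>\<^bsub>complex_ring\<^esub> v \<in> K" if "k \<in> \<rat>" "v \<in> K" for k v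
      using that Rats_subset_complex_subfield[OF K] complex_subfield_closed(6)[OF K] by auto
  qed
  hence fin: "CR.finite_dimension \<rat> K"
    using CR.subalbegra_incl_imp_finite_dimension[OF Q CR.finite_dimensionI[OF L_Q]] KL by blast
  have "CR.dimension (CR.dim \<rat> K) \<rat> K"
    using CR.finite_dimensionE[OF Q fin] by (simp add: over_def)
  hence "CR.dimension (CR.dim \<rat> K * card (conj_stabilizer t K)) \<rat> (cyclotomic_field t)"
    using CR.telescopic_base[OF Q K] dimension_cyclotomic_over_subfield[OF t K KL] by blast
  thus ?thesis using CR.dimension_is_inj[OF Q _ L_Q] by blast
qed

section \<open>Characters of a finite abelian group\<close>

abbreviation multiple :: "nat \<Rightarrow> 'g::ab_group_add \<Rightarrow> 'g" where
  "multiple k x \<equiv> x [^]\<^bsub>additive_group\<^esub> k"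

lemma additive_group_simps [simp]:
  "carrier additive_group = UNIV" "x \<otimes>\<^bsub>additive_group\<^esub> y = x + y" "\<one>\<^bsub>additive_group\<^esub> = 0"
  by (simp_all add: additive_group_def)

lemma multiple_0_left: "multiple 0 x = 0"
  using group.is_monoid[OF group_additive_group] by (simp add: monoid.nat_pow_0)

lemma multiple_Suc: "multiple (Suc k) x = multiple k x + x"
  using group.is_monoid[OF group_additive_group] by (simp add: monoid.nat_pow_Suc)

lemma multiple_add: "multiple (j + k) x = multiple j x + multiple k x"
  by (induction k) (simp_all add: multiple_0_left multiple_Suc add.assoc)

lemma multiple_0_right: "multiple k 0 = 0"
  by (induction k) (simp_all add: multiple_0_left multiple_Suc)

lemma multiple_mult: "multiple (j * k) x = multiple j (multiple k x)"
  by (induction j) (simp_all add: multiple_0_left multiple_Suc multiple_add add.commute)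

lemma multiple_uminus: "multiple k (- x) = - multiple k x"
  by (induction k) (simp_all add: multiple_0_left multiple_Suc)

lemma multiple_1: "multiple 1 x = x"
  by (simp add: multiple_Suc multiple_0_left)

definition character_on :: "'g::ab_group_add set \<Rightarrow> ('g \<Rightarrow> complex) \<Rightarrow> bool" where
  "character_on H \<psi> \<longleftrightarrow> \<psi> 0 = 1 \<and> (\<forall>x\<in>H. \<forall>y\<in>H. \<psi> (x + y) = \<psi> x * \<psi> y)"

definition characters :: "('g::ab_group_add \<Rightarrow> complex) set" where
  "characters = {\<psi>. character_on UNIV \<psi>}"

lemma charactersD:
  assumes "\<psi> \<in> characters"
  shows "\<psi> 0 = 1" "\<psi> (x + y) = \<psi> x * \<psi> y"
  using assms by (auto simp: characters_def character_on_def)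

lemma character_multiple: "\<psi> \<in> characters \<Longrightarrow> \<psi> (multiple k x) = \<psi> x ^ k"
  by (induction k) (simp_all add: multiple_0_left multiple_Suc charactersD)

lemma character_nonzero: "\<psi> \<in> characters \<Longrightarrow> \<psi> x \<noteq> 0"
  using charactersD(2)[of \<psi> x "- x"] charactersD(1)[of \<psi>] by auto

text \<open>The type argument fixes the group, which \<open>N\<close> does not determine.\<close>

locale finite_exponent =
  fixes ty :: "'g::{ab_group_add, finite} itself" and N :: nat
  assumes N_pos: "N > 0" and multiple_N: "\<And>x::'g. multiple N x = 0"
begin

definition subgp :: "'g set \<Rightarrow> bool" where
  "subgp H \<longleftrightarrow> 0 \<in> H \<and> (\<forall>x\<in>H. \<forall>y\<in>H. x - y \<in> H)"

lemma subgp_closed: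
  assumes "subgp H"
  shows "0 \<in> H" "x \<in> H \<Longrightarrow> y \<in> H \<Longrightarrow> x - y \<in> H" "x \<in> H \<Longrightarrow> - x \<in> H"
    "x \<in> H \<Longrightarrow> y \<in> H \<Longrightarrow> x + y \<in> H" "x \<in> H \<Longrightarrow> multiple k x \<in> H"
proof -
  show 1: "0 \<in> H" "x \<in> H \<Longrightarrow> y \<in> H \<Longrightarrow> x - y \<in> H" for x y
    using assms by (auto simp: subgp_def)
  show 2: "x \<in> H \<Longrightarrow> - x \<in> H" for x using 1(2)[of 0 x] 1(1) by simp
  show 3: "x \<in> H \<Longrightarrow> y \<in> H \<Longrightarrow> x + y \<in> H" for x y using 1(2)[of x "- y"] 2[of y] by simp
  show "x \<in> H \<Longrightarrow> multiple k x \<in> H"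
    by (induction k) (simp_all add: multiple_0_left multiple_Suc 1 3)
qed

lemma character_on_multiple:
  assumes "subgp H" "character_on H \<psi>" "x \<in> H"
  shows "\<psi> (multiple k x) = \<psi> x ^ k"
proof (induction k)
  case 0
  thus ?case using assms by (simp add: multiple_0_left character_on_def)
next
  case (Suc k)
  thus ?case using assms subgp_closed(5)[OF assms(1,3), of k]
    by (simp add: multiple_Suc character_on_def)
qed

text \<open>Extending a character from \<open>H\<close> to the subgroup generated by \<open>H\<close> and \<open>x\<close> amounts to choosing its value \<open>w\<close> at \<open>x\<close>. If \<open>m\<close> is
  the least positive integer with \<open>m x \<in> H\<close>, the only condition on \<open>w\<close> is \<open>w\<^sup>m = \<psi>(m x)\<close>, because \<open>d x \<in> H\<close> only for
  multiples \<open>d\<close> of \<open>m\<close>. The freedom in \<open>w\<close> is what separates the elements of the group below.\<close>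

lemma character_extend_step:
  assumes H: "subgp H" and \<psi>: "character_on H \<psi>"
    and m: "m > 0" "multiple m x \<in> H" "\<And>r. 0 < r \<Longrightarrow> r < m \<Longrightarrow> multiple r x \<notin> H"
    and w: "w ^ m = \<psi> (multiple m x)"
  shows "\<exists>H' \<xi>. subgp H' \<and> H \<subseteq> H' \<and> x \<in> H' \<and> character_on H' \<xi> \<and> (\<forall>h\<in>H. \<xi> h = \<psi> h) \<and> \<xi> x = w"
proof -
  note cl = subgp_closed[OF H]
  define H' where "H' = {h + multiple j x | h j. h \<in> H}"
  have \<psi>_add: "\<psi> (a + b) = \<psi> a * \<psi> b" if "a \<in> H" "b \<in> H" for a b
    using \<psi> that by (auto simp: character_on_def)
  have relation: "\<psi> (multiple d x) = w ^ d" if d: "multiple d x \<in> H" for d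
  proof -
    have "multiple d x = multiple (d mod m) x + multiple (d div m) (multiple m x)"
      by (metis mod_div_mult_eq multiple_add multiple_mult)
    hence "multiple (d mod m) x = multiple d x - multiple (d div m) (multiple m x)"
      by (simp add: eq_diff_eq)
    hence "multiple (d mod m) x \<in> H" using d cl m(2) by simp
    hence "d mod m = 0" using m(1) m(3)[of "d mod m"] by auto
    hence d': "d = (d div m) * m" by auto
    have "\<psi> (multiple d x) = \<psi> (multiple m x) ^ (d div m)"
      using character_on_multiple[OF H \<psi> m(2)] d' by (metis multiple_mult)
    also have "\<dots> = w ^ d" by (subst d') (simp add: mult.commute power_mult flip: w)
    finally show ?thesis .
  qed
  have wd: "\<psi> a * w ^ i = \<psi> b * w ^ j" if "a \<in> H" "b \<in> H" "a + multiple i x = b + multiple j x" "i \<le> j" for a b i j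
  proof -
    have "multiple j x = multiple (j - i) x + multiple i x"
      using that(4) multiple_add[of x "j - i" i] by simp
    hence eq: "a = b + multiple (j - i) x" using that(3) by (simp add: add.assoc[symmetric])
    hence "multiple (j - i) x = a - b" by simp
    hence in_H: "multiple (j - i) x \<in> H" using cl(2) that by simp
    have "\<psi> a * w ^ i = \<psi> b * w ^ (j - i) * w ^ i"
      unfolding eq \<psi>_add[OF that(2) in_H] relation[OF in_H] ..
    thus ?thesis using that(4) by (simp flip: power_add add: mult.assoc)
  qed
  define \<xi> where "\<xi> y = (THE v. \<exists>h j. h \<in> H \<and> y = h + multiple j x \<and> v = \<psi> h * w ^ j)" for y
  have \<xi>: "\<xi> (h + multiple j x) = \<psi> h * w ^ j" if "h \<in> H" for h j
    unfolding \<xi>_def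
  proof (rule the_equality)
    fix v assume "\<exists>h' j'. h' \<in> H \<and> h + multiple j x = h' + multiple j' x \<and> v = \<psi> h' * w ^ j'"
    then obtain h' j' where "h' \<in> H" "h + multiple j x = h' + multiple j' x" "v = \<psi> h' * w ^ j'" by blast
    thus "v = \<psi> h * w ^ j"
      using wd[of h h' j j'] wd[of h' h j' j] that by (cases "j \<le> j'") auto
  qed (use that in blast)
  have inH': "h + multiple j x \<in> H'" if "h \<in> H" for h j using that by (auto simp: H'_def)
  show ?thesis
  proof (intro exI conjI ballI)
    show "subgp H'" unfolding subgp_def
    proof (intro conjI ballI)
      show "0 \<in> H'" using inH'[of 0 0] cl by (simp add: multiple_0_left)
      fix y z assume "y \<in> H'" "z \<in> H'"
      then obtain h i h' j where yz: "h \<in> H" "y = h + multiple i x" "h' \<in> H" "z = h' + multiple j x"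
        by (auto simp: H'_def)
      (* H' is written with nonnegative multiples of x only; the exponent N provides their negatives. *)
      have neg: "multiple ((N - 1) * j) x = - multiple j x"
      proof -
        have "multiple ((N - 1) * j) x + multiple j x = multiple (N * j) x"
          using N_pos multiple_add[of x "(N - 1) * j" j] by (cases N) (simp_all add: add.commute)
        also have "\<dots> = 0" by (simp add: multiple_mult multiple_N)
        finally show ?thesis by (simp add: eq_neg_iff_add_eq_0)
      qed
      have "y - z = (h - h') + multiple (i + (N - 1) * j) x"
        unfolding yz multiple_add neg by simp
      thus "y - z \<in> H'" using inH'[OF cl(2)[OF yz(1,3)], of "i + (N - 1) * j"] by (simp only:)
    qed
    show "H \<subseteq> H'" using inH'[of _ 0] by (auto simp: multiple_0_left)
    show "x \<in> H'" using inH'[of 0 1] cl by (simp add: multiple_Suc multiple_0_left)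
    show "character_on H' \<xi>" unfolding character_on_def
    proof (intro conjI ballI)
      show "\<xi> 0 = 1" using \<xi>[of 0 0] cl \<psi> by (simp add: multiple_0_left character_on_def)
      fix y z assume "y \<in> H'" "z \<in> H'"
      then obtain h i h' j where yz: "h \<in> H" "y = h + multiple i x" "h' \<in> H" "z = h' + multiple j x"
        by (auto simp: H'_def)
      have "y + z = (h + h') + multiple (i + j) x" unfolding yz multiple_add by simp
      hence "\<xi> (y + z) = \<psi> (h + h') * w ^ (i + j)"
        using \<xi>[OF cl(4)[OF yz(1,3)], of "i + j"] by (simp only:)
      thus "\<xi> (y + z) = \<xi> y * \<xi> z" using yz by (simp add: \<xi> \<psi>_add power_add)
    qed
    show "\<xi> h = \<psi> h" if "h \<in> H" for h using \<xi>[OF that, of 0] by (simp add: multiple_0_left)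
    show "\<xi> x = w" using \<xi>[of 0 1] cl \<psi> by (simp add: multiple_Suc multiple_0_left character_on_def)
  qed
qed

lemma least_multiple_in_subgp:
  assumes "subgp H"
  obtains m where "m > 0" "multiple m x \<in> H" "\<And>r. 0 < r \<Longrightarrow> r < m \<Longrightarrow> multiple r x \<notin> H"
proof -
  define P where "P m \<longleftrightarrow> m > 0 \<and> multiple m x \<in> H" for m
  have "P N" using N_pos multiple_N subgp_closed(1)[OF assms] by (simp add: P_def)
  hence "P (LEAST m. P m)" by (rule LeastI)
  thus thesis using that[of "LEAST m. P m"] not_less_Least[of _ P] by (auto simp: P_def)
qed

lemma character_extend:
  assumes "subgp H" "character_on H \<psi>"
  shows "\<exists>\<xi>\<in>characters. \<forall>h\<in>H. \<xi> h = \<psi> h"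
  using assms
proof (induction "card (UNIV - H)" arbitrary: H \<psi> rule: less_induct)
  case less
  show ?case
  proof (cases "H = UNIV")
    case True
    thus ?thesis using less.prems by (auto simp: characters_def)
  next
    case False
    then obtain x where x: "x \<notin> H" by blast
    obtain m where m: "m > 0" "multiple m x \<in> H" "\<And>r. 0 < r \<Longrightarrow> r < m \<Longrightarrow> multiple r x \<notin> H"
      using least_multiple_in_subgp[OF less.prems(1)] by metis
    obtain w where "w ^ m = \<psi> (multiple m x)" using exists_complex_root m(1) by (metis less_irrefl)
    then obtain H' \<xi> where H': "subgp H'" "H \<subseteq> H'" "x \<in> H'" "character_on H' \<xi>" "\<forall>h\<in>H. \<xi> h = \<psi> h"
      using character_extend_step[OF less.prems m] by blast
    have "card (UNIV - H') < card (UNIV - H)"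
      using H' x by (intro psubset_card_mono) auto
    then obtain \<phi> where "\<phi> \<in> characters" "\<forall>h\<in>H'. \<phi> h = \<xi> h" using less.hyps H' by blast
    thus ?thesis using H' by (intro bexI[of _ \<phi>]) auto
  qed
qed

text \<open>On the subgroup generated by \<open>g\<close>, of order \<open>m > 1\<close>, the value at \<open>g\<close> may be any \<open>m\<close>-th root of unity, and a primitive one
  differs from \<open>1\<close>.\<close>

lemma characters_separate:
  fixes g :: 'g
  assumes "g \<noteq> 0"
  shows "\<exists>\<psi>\<in>characters. \<psi> g \<noteq> 1"
proof -
  have H: "subgp {0}" "character_on {0 :: 'g} (\<lambda>_. 1)" by (auto simp: subgp_def character_on_def)
  obtain m where m: "m > 0" "multiple m g \<in> {0}" "\<And>r. 0 < r \<Longrightarrow> r < m \<Longrightarrow> multiple r g \<notin> {0}"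
    using least_multiple_in_subgp[OF H(1)] by metis
  have "m \<noteq> 1" using m(2) assms by (auto simp: multiple_Suc multiple_0_left)
  hence "zeta m \<noteq> 1" using zeta_power_eq_iff[OF m(1), of 1 0] by (simp add: cong_def)
  moreover have "zeta m ^ m = 1" by (rule zeta_power_self[OF m(1)])
  then obtain H' \<xi> where "subgp H'" "g \<in> H'" "character_on H' \<xi>" "\<xi> g = zeta m"
    using character_extend_step[OF H m, of "zeta m"] by auto
  ultimately show ?thesis using character_extend[of H' \<xi>] by metis
qed

lemma finite_characters: "finite (characters :: ('g \<Rightarrow> complex) set)"
proof (rule finite_subset)
  show "characters \<subseteq> (UNIV :: 'g set) \<rightarrow>\<^sub>E {z. z ^ N = 1}"
    by (auto simp: multiple_N charactersD(1) PiE_def extensional_def simp flip: character_multiple)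
  show "finite ((UNIV :: 'g set) \<rightarrow>\<^sub>E {z :: complex. z ^ N = 1})"
    using N_pos by (intro finite_PiE finite_roots_unity) auto
qed

text \<open>For \<open>g \<noteq> 0\<close>, multiplication by a character \<open>\<theta>\<close> with \<open>\<theta>(g) \<noteq> 1\<close> permutes the characters and multiplies the
  sum by \<open>\<theta>(g)\<close>.\<close>

lemma sum_characters:
  fixes g :: 'g
  shows "(\<Sum>\<psi>\<in>characters. \<psi> g) = (if g = 0 then of_nat (card (characters :: ('g \<Rightarrow> complex) set)) else 0)"
proof (cases "g = 0")
  case True
  thus ?thesis by (simp add: charactersD(1))
next
  case False
  then obtain \<theta> :: "'g \<Rightarrow> complex" where \<theta>: "\<theta> \<in> characters" "\<theta> g \<noteq> 1" using characters_separate by blast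
  have closed: "(\<lambda>x. \<psi> x * \<xi> x) \<in> characters" "(\<lambda>x. \<psi> x / \<xi> x) \<in> characters"
    if "\<psi> \<in> characters" "\<xi> \<in> characters" for \<psi> \<xi> :: "'g \<Rightarrow> complex"
    using that by (auto simp: characters_def character_on_def)
  have "bij_betw (\<lambda>\<psi> x. \<psi> x * \<theta> x) characters (characters :: ('g \<Rightarrow> complex) set)"
    by (rule bij_betw_byWitness[where f' = "\<lambda>\<psi> x. \<psi> x / \<theta> x"])
      (auto simp: character_nonzero[OF \<theta>(1)] closed \<theta>(1))
  hence "(\<Sum>\<psi>\<in>characters. \<psi> g) = (\<Sum>\<psi>\<in>characters. \<psi> g * \<theta> g)"
    by (rule sum.reindex_bij_betw[symmetric])
  also have "\<dots> = (\<Sum>\<psi>\<in>characters. \<psi> g) * \<theta> g" by (simp add: sum_distrib_right)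
  finally have "(\<Sum>\<psi>\<in>characters. \<psi> g) * (\<theta> g - 1) = 0" by (simp add: algebra_simps)
  thus ?thesis using False \<theta>(2) by simp
qed

lemma sum_character_values:
  fixes \<psi> :: "'g \<Rightarrow> complex"
  assumes \<psi>: "\<psi> \<in> characters"
  shows "(\<Sum>x\<in>UNIV. \<psi> x) = (if \<psi> = (\<lambda>_. 1) then of_nat CARD('g) else 0)"
proof (cases "\<psi> = (\<lambda>_. 1)")
  case False
  then obtain a where a: "\<psi> a \<noteq> 1" by blast
  have "bij_betw (\<lambda>x. x + a) (UNIV :: 'g set) UNIV"
    by (rule bij_betw_byWitness[where f' = "\<lambda>x. x - a"]) auto
  hence "(\<Sum>x\<in>UNIV. \<psi> x) = (\<Sum>x\<in>UNIV. \<psi> (x + a))"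
    by (rule sum.reindex_bij_betw[symmetric])
  also have "\<dots> = (\<Sum>x\<in>UNIV. \<psi> x) * \<psi> a" by (simp add: charactersD(2)[OF \<psi>] sum_distrib_right)
  finally have "(\<Sum>x\<in>UNIV. \<psi> x) * (\<psi> a - 1) = 0" by (simp add: algebra_simps)
  thus ?thesis using False a by simp
qed simp

text \<open>Sum \<open>\<psi>(x)\<close> over all pairs: by columns only \<open>x = 0\<close> contributes, by rows only the trivial character does.\<close>

lemma card_characters: "card (characters :: ('g \<Rightarrow> complex) set) = CARD('g)"
proof -
  let ?C = "characters :: ('g \<Rightarrow> complex) set"
  have triv: "(\<lambda>_. 1) \<in> ?C" by (simp add: characters_def character_on_def)
  have "(of_nat (card ?C) :: complex) = (\<Sum>x\<in>UNIV. \<Sum>\<psi>\<in>?C. \<psi> x)"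
    by (simp add: sum_characters)
  also have "\<dots> = (\<Sum>\<psi>\<in>?C. \<Sum>x\<in>UNIV. \<psi> x)" by (rule sum.swap)
  also have "\<dots> = (\<Sum>\<psi>\<in>?C. if \<psi> = (\<lambda>_. 1) then of_nat CARD('g) else 0)"
    by (intro sum.cong refl sum_character_values)
  also have "\<dots> = of_nat CARD('g)" using triv finite_characters by (simp add: sum.delta)
  finally show ?thesis by (simp only: of_nat_eq_iff)
qed

text \<open>Fourier inversion at the point \<open>\<phi> r\<close>. The injection \<open>\<phi>\<close> will be multiplication by a unit.\<close>

lemma fourier_injective:
  fixes \<phi> :: "'g \<Rightarrow> 'g" and f :: "'g \<Rightarrow> complex"
  assumes "inj \<phi>" and zero: "\<And>\<psi>. \<psi> \<in> characters \<Longrightarrow> (\<Sum>s\<in>UNIV. f s * \<psi> (\<phi> s)) = 0"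
  shows "f r = 0"
proof -
  let ?C = "characters :: ('g \<Rightarrow> complex) set"
  have "0 = (\<Sum>\<psi>\<in>?C. \<psi> (- \<phi> r) * (\<Sum>s\<in>UNIV. f s * \<psi> (\<phi> s)))" by (simp add: zero)
  also have "\<dots> = (\<Sum>\<psi>\<in>?C. \<Sum>s\<in>UNIV. f s * \<psi> (\<phi> s - \<phi> r))"
    unfolding sum_distrib_left
  proof (intro sum.cong refl)
    fix \<psi> :: "'g \<Rightarrow> complex" and s assume "\<psi> \<in> ?C"
    thus "\<psi> (- \<phi> r) * (f s * \<psi> (\<phi> s)) = f s * \<psi> (\<phi> s - \<phi> r)"
      using charactersD(2)[of \<psi> "\<phi> s" "- \<phi> r"] by simp
  qed
  also have "\<dots> = (\<Sum>s\<in>UNIV. f s * (\<Sum>\<psi>\<in>?C. \<psi> (\<phi> s - \<phi> r)))"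
    by (subst sum.swap) (simp add: sum_distrib_left)
  also have "\<dots> = (\<Sum>s\<in>UNIV. if s = r then f s * of_nat CARD('g) else 0)"
    using assms(1) by (intro sum.cong refl) (auto simp: sum_characters card_characters inj_eq)
  also have "\<dots> = f r * of_nat CARD('g)" by (simp add: sum.delta)
  finally show ?thesis by simp
qed

section \<open>The spectrum of a matrix invariant under translations\<close>

lemma character_bijection: "\<exists>ch. bij_betw ch (UNIV :: 'g set) (characters :: ('g \<Rightarrow> complex) set)"
  using finite_same_card_bij[of "UNIV :: 'g set" characters] finite_characters card_characters
  by (metis finite_class.finite_UNIV)

text \<open>The characters are linearly independent eigenvectors: the matrix \<open>U\<close> whose columns they are satisfies
  \<open>M U = U D\<close> with \<open>D\<close> diagonal, and \<open>U\<close> is invertible because the column relations say \<open>U W = |G|\<close> for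
  \<open>W\<^sub>j\<^sub>u = \<psi>\<^sub>j(-u)\<close>. All matrices are taken over the polynomial ring, so that \<open>x - M\<close> and \<open>x - D\<close> can be
  compared through multiplicativity of determinants.\<close>

lemma charpoly_circulant:
  fixes c :: "'g \<Rightarrow> complex" and M :: "((complex, 'g) vec, 'g) vec"
  assumes M: "\<And>u v. M $ u $ v = c (v - u)"
  shows "charpoly M = (\<Prod>\<psi>\<in>characters. [:- (\<Sum>s\<in>UNIV. c s * \<psi> s), 1:])"
proof -
  obtain ch where ch: "bij_betw ch (UNIV :: 'g set) (characters :: ('g \<Rightarrow> complex) set)"
    using character_bijection by blast
  have ch_char: "ch j \<in> characters" for j using ch by (auto simp: bij_betw_def)
  define ev where "ev = (\<lambda>j. \<Sum>s\<in>UNIV. c s * ch j s)"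
  define P :: "((complex poly, 'g) vec, 'g) vec" where "P = mat [:0, 1:] - map_matrix (\<lambda>c. [:c:]) M"
  define U :: "((complex poly, 'g) vec, 'g) vec" where "U = (\<chi> u j. [:ch j u:])"
  define W :: "((complex poly, 'g) vec, 'g) vec" where "W = (\<chi> j u. [:ch j (- u):])"
  define D :: "((complex poly, 'g) vec, 'g) vec" where "D = (\<chi> i j. if i = j then [:- ev j, 1:] else 0)"
  have eigen: "(\<Sum>v\<in>UNIV. M $ u $ v * ch j v) = ev j * ch j u" for u j
  proof -
    have "bij_betw (\<lambda>s. s + u) (UNIV :: 'g set) UNIV"
      by (rule bij_betw_byWitness[where f' = "\<lambda>x. x - u"]) auto
    hence "(\<Sum>v\<in>UNIV. M $ u $ v * ch j v) = (\<Sum>s\<in>UNIV. M $ u $ (s + u) * ch j (s + u))"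
      by (rule sum.reindex_bij_betw[symmetric])
    thus ?thesis by (simp add: M charactersD(2)[OF ch_char] ev_def sum_distrib_right mult.assoc)
  qed
  have PU: "P ** U = U ** D"
  proof -
    have "(P ** U) $ u $ j = (U ** D) $ u $ j" for u j
    proof -
      have "(P ** U) $ u $ j = (\<Sum>v\<in>UNIV. (if u = v then [:0, 1:] * [:ch j v:] else 0) - [:M $ u $ v * ch j v:])"
        unfolding matrix_matrix_mult_def P_def U_def mat_def map_matrix_def
        by (auto intro!: sum.cong simp: algebra_simps)
      also have "\<dots> = [:0, ch j u:] - [:\<Sum>v\<in>UNIV. M $ u $ v * ch j v:]"
        by (simp add: sum_subtractf sum.delta sum_to_poly)
      also have "\<dots> = [:ch j u:] * [:- ev j, 1:]" unfolding eigen by (simp add: mult.commute)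
      also have "\<dots> = (\<Sum>k\<in>UNIV. if k = j then [:ch k u:] * [:- ev j, 1:] else 0)"
        by (simp add: sum.delta)
      also have "\<dots> = (U ** D) $ u $ j"
        unfolding matrix_matrix_mult_def U_def D_def vec_lambda_beta by (intro sum.cong refl) simp
      finally show ?thesis .
    qed
    thus ?thesis by (simp add: vec_eq_iff)
  qed
  have UW: "U ** W = mat (of_nat CARD('g))"
  proof -
    have "(U ** W) $ u $ v = mat (of_nat CARD('g)) $ u $ v" for u v
    proof -
      have "(U ** W) $ u $ v = [:\<Sum>j\<in>UNIV. ch j (u - v):]"
        unfolding matrix_matrix_mult_def U_def W_def
        using charactersD(2)[OF ch_char, of _ u "- v"] by (simp add: sum_to_poly mult.commute)
      also have "(\<Sum>j\<in>UNIV. ch j (u - v)) = (\<Sum>\<psi>\<in>characters. \<psi> (u - v))"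
        by (rule sum.reindex_bij_betw[OF ch])
      finally show ?thesis by (simp add: sum_characters card_characters mat_def of_nat_poly)
    qed
    thus ?thesis by (simp add: vec_eq_iff)
  qed
  have "det U * det W = (\<Prod>i\<in>(UNIV :: 'g set). of_nat CARD('g))"
    unfolding det_mul[symmetric] UW by (subst det_diagonal) (auto simp: mat_def)
  hence "det U \<noteq> 0" by (auto simp: prod_zero_iff)
  moreover have "det P * det U = det U * det D"
    using PU by (metis det_mul)
  ultimately have "det P = det D" by (simp add: mult.commute)
  also have "det D = (\<Prod>j\<in>UNIV. [:- ev j, 1:])"
    by (subst det_diagonal) (auto simp: D_def)
  also have "\<dots> = (\<Prod>\<psi>\<in>characters. [:- (\<Sum>s\<in>UNIV. c s * \<psi> s), 1:])"
    unfolding ev_def by (rule prod.reindex_bij_betw[OF ch])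
  finally show ?thesis by (simp add: charpoly_def P_def)
qed

end

section \<open>The splitting field of a mixed Cayley graph\<close>

lemma group_exponent_additive_group:
  fixes n :: nat
  assumes n: "group_exponent (additive_group :: 'g::{ab_group_add, finite} monoid) = n"
  shows "n > 0" "multiple n (x :: 'g) = 0"
proof -
  let ?G = "additive_group :: 'g monoid"
  interpret G: group ?G by (rule group_additive_group)
  have "finite (range (G.ord))" by simp
  moreover have "G.ord a \<noteq> 0" for a using G.ord_ge_1[of a] by simp
  hence "0 \<notin> range G.ord" by (metis rangeE)
  ultimately have "Lcm (range G.ord) \<noteq> 0" using Lcm_0_iff[of "range G.ord"] by blast
  thus "n > 0" using n unfolding group_exponent_def additive_group_simps(1) by (metis neq0_conv)
  have "G.ord x dvd n" using n by (auto simp: group_exponent_def)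
  then obtain q where q: "n = G.ord x * q" by (elim dvdE)
  have "multiple (G.ord x) x = 0" using G.pow_ord_eq_1[of x] by simp
  thus "multiple n x = 0" unfolding q by (metis mult.commute multiple_mult multiple_0_right)
qed

text \<open>The entry of the Hermitian adjacency matrix as a function of the difference of its indices.\<close>

definition connection :: "'g::ab_group_add set \<Rightarrow> 'g set \<Rightarrow> 'g \<Rightarrow> complex" where
  "connection A B s = (if s \<in> A then 1 else if s \<in> B then \<i> else if - s \<in> B then - \<i> else 0)"

definition cayley_eigenvalue :: "'g::{ab_group_add, finite} set \<Rightarrow> 'g set \<Rightarrow> ('g \<Rightarrow> complex) \<Rightarrow> complex" where
  "cayley_eigenvalue A B \<psi> = (\<Sum>s\<in>UNIV. connection A B s * \<psi> s)"

text \<open>The symmetry of \<open>A\<close> matters because an edge is an unordered pair.\<close>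

lemma hermitian_adjacency_mixed_cayley:
  fixes A B :: "'g::{ab_group_add, finite} set"
  assumes "A = uminus ` A"
  shows "hermitian_adjacency (mixed_cayley A B) $ u $ v = connection A B (v - u)"
proof -
  have sym: "x \<in> A \<longleftrightarrow> - x \<in> A" for x using assms by (metis image_eqI minus_minus image_iff)
  have "{u, v} \<in> edges (mixed_cayley A B) \<longleftrightarrow> v - u \<in> A"
    using sym[of "v - u"] by (auto simp: mixed_cayley_def doubleton_eq_iff)
  thus ?thesis by (simp add: hermitian_adjacency_def connection_def mixed_cayley_def)
qed

lemma splits_over_prod_iff:
  assumes K: "subfield K complex_ring" and "finite I"
  shows "splits_over K (\<Prod>i\<in>I. [:- f i, 1:]) \<longleftrightarrow> f ` I \<subseteq> K"
proof
  assume "splits_over K (\<Prod>i\<in>I. [:- f i, 1:])"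
  then obtain c rs where rs: "set rs \<subseteq> K" "(\<Prod>i\<in>I. [:- f i, 1:]) = smult c (\<Prod>r\<leftarrow>rs. [:- r, 1:])"
    unfolding splits_over_def by blast
  have "(\<Prod>i\<in>I. [:- f i, 1:]) \<noteq> 0" using assms(2) by (auto simp: prod_zero_iff)
  hence c: "c \<noteq> 0" using rs(2) by auto
  show "f ` I \<subseteq> K"
  proof
    fix z assume "z \<in> f ` I"
    hence "poly (\<Prod>i\<in>I. [:- f i, 1:]) z = 0" using assms(2) by (auto simp: poly_prod prod_zero_iff)
    hence "poly (\<Prod>r\<leftarrow>rs. [:- r, 1:]) z = 0" using c unfolding rs(2) by simp
    hence "z \<in> set rs" by (induction rs) auto
    thus "z \<in> K" using rs(1) by blast
  qed
next
  assume sub: "f ` I \<subseteq> K"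
  obtain xs where xs: "set xs = I" "distinct xs" using finite_distinct_list[OF assms(2)] by blast
  have "(\<Prod>i\<in>I. [:- f i, 1:]) = smult 1 (\<Prod>r\<leftarrow>map f xs. [:- r, 1:])"
    using prod.distinct_set_conv_list[OF xs(2), of "\<lambda>i. [:- f i, 1:]"] xs(1) by (simp add: comp_def)
  thus "splits_over K (\<Prod>i\<in>I. [:- f i, 1:])"
    unfolding splits_over_def using sub xs(1) complex_subfield_closed(2)[OF K]
    by (intro bexI[of _ 1] exI[of _ "map f xs"]) auto
qed

text \<open>A subfield splits a product of linear factors exactly when it contains the roots, so the hull runs over the
  subfields that contain all eigenvalues.\<close>

lemma splitting_field_mixed_cayley:
  fixes A B :: "'g::{ab_group_add, finite} set"
  assumes "finite_exponent TYPE('g) N" and A: "A = uminus ` A"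
  shows "splitting_field (mixed_cayley A B) =
    generate_field complex_ring (cayley_eigenvalue A B ` characters)"
proof -
  interpret finite_exponent "TYPE('g)" N by fact
  have cp: "charpoly (hermitian_adjacency (mixed_cayley A B)) =
      (\<Prod>\<psi>\<in>characters. [:- cayley_eigenvalue A B \<psi>, 1:])"
    unfolding cayley_eigenvalue_def
    by (rule charpoly_circulant) (rule hermitian_adjacency_mixed_cayley[OF A])
  show ?thesis
    unfolding splitting_field_def hull_def
    using field.generate_field_min_subfield2[OF field_complex_ring, of "cayley_eigenvalue A B ` characters"]
      splits_over_prod_iff[OF _ finite_characters, of _ "cayley_eigenvalue A B"]
      Rats_subset_complex_subfield
    by (auto simp: cp)
qed

context
  fixes n :: nat and A B :: "'g::{ab_group_add, finite} set"
  assumes fe: "finite_exponent TYPE('g) n"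
    and AB: "A \<inter> B = {}" "A = uminus ` A" "B \<inter> uminus ` B = {}"
begin

interpretation finite_exponent "TYPE('g)" n by (rule fe)

text \<open>The factor 4 in \<open>4 n\<close> is there to make \<open>\<i>\<close> a power of \<open>\<zeta>\<close>.\<close>

lemma zeta_4n_power_n: "zeta (4 * n) ^ n = \<i>"
proof -
  have "zeta (4 * n) ^ n = exp (of_nat n * (2 * of_real pi * \<i> / of_nat (4 * n)))"
    unfolding zeta_def by (simp only: exp_of_nat_mult)
  also have "of_nat n * (2 * of_real pi * \<i> / of_nat (4 * n)) = of_real pi / 2 * \<i>"
    using N_pos by (simp add: field_simps)
  also have "exp \<dots> = \<i>" using exp_Euler[of "pi / 2"] by (simp add: mult.commute)
  finally show ?thesis .
qed

lemma character_value_zeta_power: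
  fixes s :: 'g
  assumes "\<psi> \<in> characters"
  obtains j where "\<psi> s = zeta (4 * n) ^ j"
proof -
  have "\<psi> s ^ n = 1" using character_multiple[OF assms, of s n] by (simp add: multiple_N charactersD(1)[OF assms])
  hence "\<psi> s ^ (4 * n) = 1" by (metis mult.commute power_mult power_one)
  thus thesis
    using that complex_roots_unity[of "4 * n"] N_pos
    unfolding zeta_def exp_of_nat_mult[symmetric] by (auto simp: mult_ac)
qed

lemma connection_in: "connection A B s \<in> cyclotomic_field (4 * n)"
  using zeta_power_in[of "4 * n" n] complex_subfield_closed(1-3)[OF subfield_cyclotomic_field[of "4 * n"]]
  unfolding connection_def zeta_4n_power_n by auto

lemma character_value_in: "\<psi> \<in> characters \<Longrightarrow> \<psi> (s :: 'g) \<in> cyclotomic_field (4 * n)"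
  by (metis character_value_zeta_power zeta_power_in)

lemma cayley_eigenvalue_in:
  "\<psi> \<in> characters \<Longrightarrow> cayley_eigenvalue A B \<psi> \<in> cyclotomic_field (4 * n)"
  unfolding cayley_eigenvalue_def
  by (intro complex_subfield_sum[OF subfield_cyclotomic_field] complex_subfield_closed(6)[OF subfield_cyclotomic_field]
      connection_in character_value_in)

lemma connection_iffs:
  "connection A B s = 1 \<longleftrightarrow> s \<in> A" "connection A B s = \<i> \<longleftrightarrow> s \<in> B"
  "connection A B s = - \<i> \<longleftrightarrow> - s \<in> B"
  "connection A B s \<in> {0, 1, \<i>, - \<i>}"
proof -
  have sym: "x \<in> A \<longleftrightarrow> - x \<in> A" for x using AB(2) by (metis image_eqI minus_minus image_iff)
  have B: "\<not> (x \<in> B \<and> - x \<in> B)" for x using AB(3) by (metis IntI empty_iff imageI minus_minus)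
  have AnB: "\<not> (x \<in> A \<and> x \<in> B)" for x using AB(1) by blast
  have ne: "\<i> \<noteq> - \<i>" "- \<i> \<noteq> \<i>" "1 \<noteq> - \<i>" "- \<i> \<noteq> 1" "1 \<noteq> \<i>" "\<i> \<noteq> 1"
    by (simp_all add: complex_eq_iff)
  show "connection A B s = 1 \<longleftrightarrow> s \<in> A" "connection A B s = \<i> \<longleftrightarrow> s \<in> B"
    "connection A B s = - \<i> \<longleftrightarrow> - s \<in> B" "connection A B s \<in> {0, 1, \<i>, - \<i>}"
    using sym[of s] B[of s] AnB[of s] AnB[of "- s"] ne by (auto simp: connection_def)
qed

context
  fixes k :: nat
  assumes k: "k \<in> totatives (4 * n)"
begin

lemma coprime_k: "coprime k (4 * n)" "coprime k n" "odd k"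
proof -
  show c: "coprime k (4 * n)" using k by (simp add: totatives_def)
  thus "coprime k n" by simp
  from c have "coprime k 4" by simp
  thus "odd k" by (metis coprime_common_divisor dvd_refl even_numeral odd_one)
qed

lemma four_n_pos: "4 * n > 0" "4 * n > 1"
  using N_pos by simp_all

lemma inj_multiple: "inj (multiple k :: 'g \<Rightarrow> 'g)"
proof -
  obtain j where j: "[k * j = 1] (mod n)" using coprime_k(2) cong_solve_coprime_nat by (metis One_nat_def)
  have "multiple j (multiple k x) = x" for x :: 'g
  proof -
    have mod: "multiple (m mod n) x = multiple m x" for m
    proof -
      have "multiple m x = multiple (m mod n) x + multiple (m div n) (multiple n x)"
        by (metis mod_div_mult_eq multiple_add multiple_mult)
      thus ?thesis by (simp add: multiple_N multiple_0_right)
    qed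
    have "multiple j (multiple k x) = multiple ((k * j) mod n) x"
      unfolding mod by (metis mult.commute multiple_mult)
    also have "\<dots> = multiple (1 mod n) x" using j by (simp only: cong_def)
    also have "\<dots> = x" unfolding mod by (rule multiple_1)
    finally show ?thesis .
  qed
  thus ?thesis by (metis injI)
qed

lemma conj_i: "cyclotomic_conj (4 * n) k \<i> = \<i> ^ k"
proof -
  have "cyclotomic_conj (4 * n) k (zeta (4 * n) ^ n) = (zeta (4 * n) ^ n) ^ k"
    unfolding cyclotomic_conj_zeta_power[OF four_n_pos(1) coprime_k(1)]
    by (simp add: mult.commute flip: power_mult)
  thus ?thesis by (simp only: zeta_4n_power_n)
qed

lemma conj_character:
  assumes "\<psi> \<in> characters"
  shows "cyclotomic_conj (4 * n) k (\<psi> s) = \<psi> (multiple k (s :: 'g))"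
proof -
  obtain j where j: "\<psi> s = zeta (4 * n) ^ j" using character_value_zeta_power[OF assms] by metis
  show ?thesis
    unfolding character_multiple[OF assms] j cyclotomic_conj_zeta_power[OF four_n_pos(1) coprime_k(1)]
    by (simp add: mult.commute flip: power_mult)
qed

lemma k_cases: "[k = 1] (mod 4) \<and> \<i> ^ k = \<i> \<or> [k = 3] (mod 4) \<and> \<i> ^ k = - \<i>"
proof -
  have r: "k mod 4 = 1 \<or> k mod 4 = 3" using coprime_k(3) by presburger
  have "\<i> ^ k = (\<i> ^ 4) ^ (k div 4) * \<i> ^ (k mod 4)"
    by (metis mult_div_mod_eq power_add power_mult)
  also have "\<i> ^ 4 = 1" by (simp add: power4_eq_xxxx)
  finally have "\<i> ^ k = \<i> ^ (k mod 4)" by simp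
  thus ?thesis using r by (auto simp: cong_def power3_eq_cube)
qed

text \<open>Both sides are Fourier sums over \<open>\<psi>(k s)\<close>: conjugation turns \<open>\<psi>(s)\<close> into \<open>\<psi>(k s)\<close>, and the eigenvalue itself is
  brought to this form by reindexing along the bijection \<open>s \<mapsto> k s\<close>. Injectivity of the Fourier transform compares the
  coefficients.\<close>

lemma eigenvalues_fixed_iff:
  "(\<forall>\<psi>\<in>characters. cyclotomic_conj (4 * n) k (cayley_eigenvalue A B \<psi>) = cayley_eigenvalue A B \<psi>) \<longleftrightarrow>
   (\<forall>s. cyclotomic_conj (4 * n) k (connection A B s) = connection A B (multiple k s))"
proof -
  let ?\<sigma> = "cyclotomic_conj (4 * n) k" and ?c = "connection A B"
  have bij: "bij (multiple k :: 'g \<Rightarrow> 'g)"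
    using inj_multiple finite_UNIV_inj_surj[OF finite_class.finite_UNIV inj_multiple] by (simp add: bij_def)
  have conj: "?\<sigma> (cayley_eigenvalue A B \<psi>) = (\<Sum>s\<in>UNIV. ?\<sigma> (?c s) * \<psi> (multiple k s))" if "\<psi> \<in> characters" for \<psi>
    unfolding cayley_eigenvalue_def
    using that connection_in character_value_in complex_subfield_closed(6)[OF subfield_cyclotomic_field]
    by (subst cyclotomic_conj_sum[OF four_n_pos(1) coprime_k(1)])
      (auto simp: cyclotomic_conj_mult[OF four_n_pos(1) coprime_k(1)] conj_character)
  have ev: "cayley_eigenvalue A B \<psi> = (\<Sum>s\<in>UNIV. ?c (multiple k s) * \<psi> (multiple k s))" for \<psi>
    unfolding cayley_eigenvalue_def by (rule sum.reindex_bij_betw[OF bij, symmetric])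
  show ?thesis
  proof
    assume fixed: "\<forall>\<psi>\<in>characters. ?\<sigma> (cayley_eigenvalue A B \<psi>) = cayley_eigenvalue A B \<psi>"
    have "?\<sigma> (?c r) - ?c (multiple k r) = 0" for r
    proof (rule fourier_injective[OF inj_multiple, where f = "\<lambda>s. ?\<sigma> (?c s) - ?c (multiple k s)"])
      fix \<psi> :: "'g \<Rightarrow> complex" assume "\<psi> \<in> characters"
      thus "(\<Sum>s\<in>UNIV. (?\<sigma> (?c s) - ?c (multiple k s)) * \<psi> (multiple k s)) = 0"
        using fixed conj ev by (simp add: left_diff_distrib sum_subtractf)
    qed
    thus "\<forall>s. ?\<sigma> (?c s) = ?c (multiple k s)" by simp
  next
    assume "\<forall>s. ?\<sigma> (?c s) = ?c (multiple k s)"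
    thus "\<forall>\<psi>\<in>characters. ?\<sigma> (cayley_eigenvalue A B \<psi>) = cayley_eigenvalue A B \<psi>"
      using conj ev by simp
  qed
qed

lemma dilate_eq_iff: "dilate k (T :: 'g set) = T' \<longleftrightarrow> (\<forall>s. multiple k s \<in> T' \<longleftrightarrow> s \<in> T)"
proof -
  have mem: "multiple k s \<in> dilate k T \<longleftrightarrow> s \<in> T" for s
    unfolding dilate_def by (rule inj_image_mem_iff[OF inj_multiple])
  have surj: "surj (multiple k :: 'g \<Rightarrow> 'g)"
    by (rule finite_UNIV_inj_surj[OF finite_class.finite_UNIV inj_multiple])
  show ?thesis
  proof
    assume R: "\<forall>s. multiple k s \<in> T' \<longleftrightarrow> s \<in> T"
    show "dilate k T = T'"
    proof (rule Set.set_eqI)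
      fix y :: 'g
      obtain s where "y = multiple k s" using surj by (rule surjE)
      thus "y \<in> dilate k T \<longleftrightarrow> y \<in> T'" using mem R by simp
    qed
  qed (use mem in simp)
qed

text \<open>The conjugation fixes \<open>0\<close> and \<open>1\<close> and sends \<open>\<i>\<close> to \<open>\<i>\<^sup>k\<close>, which is \<open>\<i>\<close> or \<open>-\<i>\<close> according to \<open>k\<close> modulo 4. Comparing
  where the two functions take the values \<open>1\<close>, \<open>\<i>\<close> and \<open>-\<i>\<close> gives the conditions on \<open>A\<close>, \<open>B\<close> and \<open>-B\<close>.\<close>

lemma connection_equivariant_iff:
  "(\<forall>s. cyclotomic_conj (4 * n) k (connection A B s) = connection A B (multiple k s)) \<longleftrightarrow>
   k \<in> unit_stabilizer n A B"
proof -
  let ?\<sigma> = "cyclotomic_conj (4 * n) k" and ?c = "connection A B"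
  note rat = cyclotomic_conj_Rats[OF four_n_pos(1) coprime_k(1)]
  have \<sigma>i: "?\<sigma> (- \<i>) = - (\<i> ^ k)"
    using cyclotomic_conj_uminus[OF four_n_pos(1) coprime_k(1), of \<i>] zeta_power_in[of "4 * n" n]
    by (simp add: zeta_4n_power_n conj_i)
  have ne: "\<i> \<noteq> - \<i>" "- \<i> \<noteq> \<i>" "1 \<noteq> - \<i>" "- \<i> \<noteq> 1" "1 \<noteq> \<i>" "\<i> \<noteq> 1"
    by (simp_all add: complex_eq_iff)
  have neg: "x \<in> uminus ` B \<longleftrightarrow> - x \<in> B" for x by (metis image_eqI image_iff minus_minus)
  have st: "k \<in> unit_stabilizer n A B \<longleftrightarrow> (\<forall>s. multiple k s \<in> A \<longleftrightarrow> s \<in> A) \<and>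
     ([k = 1] (mod 4) \<longrightarrow> (\<forall>s. multiple k s \<in> B \<longleftrightarrow> s \<in> B)) \<and>
     ([k = 3] (mod 4) \<longrightarrow> (\<forall>s. - multiple k s \<in> B \<longleftrightarrow> s \<in> B))"
    using k N_pos unfolding unit_stabilizer_def dilate_eq_iff neg_units_1_mod_4_eq[OF N_pos]
    by (auto simp: units_1_mod_4_def dilate_eq_iff neg)
  have four: "z \<in> {0, 1, \<i>, - \<i>} \<Longrightarrow> w \<in> {0, 1, \<i>, - \<i>} \<Longrightarrow>
      z = w \<longleftrightarrow> (z = 1 \<longleftrightarrow> w = 1) \<and> (z = \<i> \<longleftrightarrow> w = \<i>) \<and> (z = - \<i> \<longleftrightarrow> w = - \<i>)" for z w
    using ne by auto
  note ci = connection_iffs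
  have neg_mult: "- multiple k s = multiple k (- s)" for s :: 'g
    by (simp add: multiple_uminus)
  from k_cases show ?thesis
  proof (elim disjE conjE)
    assume k1: "[k = 1] (mod 4)" "\<i> ^ k = \<i>"
    have not3: "\<not> [k = 3] (mod 4)" using k1(1) by (simp add: cong_def)
    have "?\<sigma> (?c s) = ?c s" for s
      using ci(4)[of s] k1(2) \<sigma>i conj_i rat by auto
    hence eq: "?\<sigma> (?c s) = ?c (multiple k s) \<longleftrightarrow> (multiple k s \<in> A \<longleftrightarrow> s \<in> A) \<and>
        (multiple k s \<in> B \<longleftrightarrow> s \<in> B) \<and> (- multiple k s \<in> B \<longleftrightarrow> - s \<in> B)" for s
      using four[OF ci(4)[of s] ci(4)[of "multiple k s"]] by (auto simp: ci(1-3))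
    have "(\<forall>s. - multiple k s \<in> B \<longleftrightarrow> - s \<in> B) \<longleftrightarrow> (\<forall>s. multiple k s \<in> B \<longleftrightarrow> s \<in> B)"
      unfolding neg_mult by (metis minus_minus)
    thus ?thesis unfolding eq st all_conj_distrib using k1(1) not3 by simp
  next
    assume k3: "[k = 3] (mod 4)" "\<i> ^ k = - \<i>"
    have not1: "\<not> [k = 1] (mod 4)" using k3(1) by (simp add: cong_def)
    have \<sigma>: "?\<sigma> (?c s) = (if ?c s = \<i> then - \<i> else if ?c s = - \<i> then \<i> else ?c s)" for s
      using ci(4)[of s] k3(2) \<sigma>i conj_i rat ne by auto
    have in4: "?\<sigma> (?c s) \<in> {0, 1, \<i>, - \<i>}" for s
      unfolding \<sigma> using ci(4)[of s] by auto
    have "?\<sigma> (?c s) = 1 \<longleftrightarrow> s \<in> A" "?\<sigma> (?c s) = \<i> \<longleftrightarrow> - s \<in> B" "?\<sigma> (?c s) = - \<i> \<longleftrightarrow> s \<in> B" for s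
      unfolding \<sigma> using ci(1)[of s] ci(2)[of s] ci(3)[of s] ci(4)[of s] ne by auto
    hence eq: "?\<sigma> (?c s) = ?c (multiple k s) \<longleftrightarrow> (multiple k s \<in> A \<longleftrightarrow> s \<in> A) \<and>
        (multiple k s \<in> B \<longleftrightarrow> - s \<in> B) \<and> (- multiple k s \<in> B \<longleftrightarrow> s \<in> B)" for s
      using four[OF in4[of s] ci(4)[of "multiple k s"]] by (auto simp: ci(1-3))
    have "(\<forall>s. multiple k s \<in> B \<longleftrightarrow> - s \<in> B) \<longleftrightarrow> (\<forall>s. - multiple k s \<in> B \<longleftrightarrow> s \<in> B)"
      unfolding neg_mult by (metis minus_minus)
    thus ?thesis unfolding eq st all_conj_distrib using k3(1) not1 by simp
  qed
qed

text \<open>The elements fixed by a conjugation form a subfield.\<close>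

lemma fixes_generated_field_iff:
  fixes E :: "complex set"
  assumes E: "E \<subseteq> cyclotomic_field (4 * n)"
  shows "(\<forall>x\<in>generate_field complex_ring E. cyclotomic_conj (4 * n) k x = x) \<longleftrightarrow>
    (\<forall>x\<in>E. cyclotomic_conj (4 * n) k x = x)"
proof
  let ?\<sigma> = "cyclotomic_conj (4 * n) k" and ?L = "cyclotomic_field (4 * n)"
  note L = complex_subfield_closed[OF subfield_cyclotomic_field[of "4 * n"]]
  assume fixed: "\<forall>x\<in>E. ?\<sigma> x = x"
  define P where "P = {x \<in> ?L. ?\<sigma> x = x}"
  have rat: "?\<sigma> q = q" if "q \<in> \<rat>" for q
    using cyclotomic_conj_Rats[OF four_n_pos(1) coprime_k(1) that] .
  have "subfield P complex_ring"
    unfolding complex_subfield_iff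
  proof (intro conjI ballI)
    show "1 \<in> P" using L(2) rat[of 1] by (simp add: P_def)
    fix x y assume "x \<in> P" "y \<in> P"
    thus "x - y \<in> P" "x * y \<in> P"
      using L(5,6) cyclotomic_conj_diff[OF four_n_pos(1) coprime_k(1)]
        cyclotomic_conj_mult[OF four_n_pos(1) coprime_k(1)] by (auto simp: P_def)
  next
    fix x assume x: "x \<in> P"
    show "inverse x \<in> P"
    proof (cases "x = 0")
      case False
      have "?\<sigma> (x * inverse x) = ?\<sigma> x * ?\<sigma> (inverse x)"
        using x L(7) by (intro cyclotomic_conj_mult[OF four_n_pos(1) coprime_k(1)]) (auto simp: P_def)
      hence "1 = x * ?\<sigma> (inverse x)" using False x rat[of 1] by (simp add: P_def)
      hence "?\<sigma> (inverse x) = inverse x" by (metis inverse_unique)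
      thus ?thesis using x L(7) by (simp add: P_def)
    qed (use x in simp)
  qed
  moreover have "E \<subseteq> P" using E fixed by (auto simp: P_def)
  ultimately have "generate_field complex_ring E \<subseteq> P"
    by (intro field.generate_field_min_subfield1[OF field_complex_ring]) auto
  thus "\<forall>x\<in>generate_field complex_ring E. ?\<sigma> x = x" by (auto simp: P_def)
qed (auto intro: generate_field.incl)

end

lemma splitting_field_subfield:
  "subfield (splitting_field (mixed_cayley A B)) complex_ring"
  "splitting_field (mixed_cayley A B) \<subseteq> cyclotomic_field (4 * n)"
proof -
  show "subfield (splitting_field (mixed_cayley A B)) complex_ring"
    unfolding splitting_field_mixed_cayley[OF fe AB(2)]
    by (intro field.generate_field_is_subfield[OF field_complex_ring]) simp
  show "splitting_field (mixed_cayley A B) \<subseteq> cyclotomic_field (4 * n)"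
    unfolding splitting_field_mixed_cayley[OF fe AB(2)]
    using cayley_eigenvalue_in
    by (intro field.generate_field_min_subfield1[OF field_complex_ring] subfield_cyclotomic_field) auto
qed

lemma conj_stabilizer_splitting_field:
  "conj_stabilizer (4 * n) (splitting_field (mixed_cayley A B)) = unit_stabilizer n A B"
proof -
  have E: "cayley_eigenvalue A B ` characters \<subseteq> cyclotomic_field (4 * n)"
    using cayley_eigenvalue_in by blast
  have "k \<in> conj_stabilizer (4 * n) (splitting_field (mixed_cayley A B)) \<longleftrightarrow> k \<in> unit_stabilizer n A B"
    if k: "k \<in> totatives (4 * n)" for k
    using fixes_generated_field_iff[OF k E] eigenvalues_fixed_iff[OF k] connection_equivariant_iff[OF k] k
    by (simp add: conj_stabilizer_def splitting_field_mixed_cayley[OF fe AB(2)])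
  moreover have "conj_stabilizer (4 * n) (splitting_field (mixed_cayley A B)) \<subseteq> totatives (4 * n)"
    "unit_stabilizer n A B \<subseteq> totatives (4 * n)"
    by (auto simp: conj_stabilizer_def unit_stabilizer_def)
  ultimately show ?thesis by blast
qed

end

theorem theorem1:
  fixes S A B :: "'g::{ab_group_add, finite} set" and n :: nat
  assumes "group_exponent (additive_group :: 'g monoid) = n"
    and "S \<subseteq> UNIV - {0}"
    and "S = A \<union> B"
    and "A \<inter> B = {}"
    and "A = uminus ` A"
    and "B \<inter> uminus ` B = {}"
  shows "splitting_field (mixed_cayley A B) =
           fixed_field (cyclotomic_field (4 * n))
             {\<sigma> \<in> galois_group (cyclotomic_field (4 * n)) \<rat>.
                eta (4 * n) \<sigma> \<in> unit_stabilizer n A B}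
         \<and> real (algebraic_degree (mixed_cayley A B)) =
           real (totient (4 * n)) / real (card (unit_stabilizer n A B))"
proof -
  let ?SF = "splitting_field (mixed_cayley A B)"
  have n: "n > 0" using group_exponent_additive_group(1)[OF assms(1)] .
  have fe: "finite_exponent TYPE('g) n"
    by (intro finite_exponent.intro) (use group_exponent_additive_group[OF assms(1)] in auto)
  note AB = assms(4-6)
  have t: "4 * n > 0" "4 * n > 1" using n by simp_all
  have H: "conj_stabilizer (4 * n) ?SF = unit_stabilizer n A B"
    by (rule conj_stabilizer_splitting_field[OF fe AB])
  have sf: "subfield ?SF complex_ring" "?SF \<subseteq> cyclotomic_field (4 * n)"
    by (rule splitting_field_subfield[OF fe AB])+
  have sub: "unit_stabilizer n A B \<subseteq> totatives (4 * n)" by (auto simp: unit_stabilizer_def)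
  have "?SF = fixed_field (cyclotomic_field (4 * n))
      {\<sigma> \<in> galois_group (cyclotomic_field (4 * n)) \<rat>. eta (4 * n) \<sigma> \<in> unit_stabilizer n A B}"
    unfolding fixed_field_cyclotomic[OF t(2) sub]
    using fixed_by_conj_stabilizer[OF t(1) sf] unfolding H by simp
  moreover have "algebraic_degree (mixed_cayley A B) * card (unit_stabilizer n A B) = totient (4 * n)"
    using dim_intermediate_field[OF t(1) sf] unfolding H algebraic_degree_def .
  moreover from this have "card (unit_stabilizer n A B) \<noteq> 0"
    using t(1) by (metis mult_0_right totient_0_iff less_irrefl)
  ultimately show ?thesis by (metis nonzero_eq_divide_eq of_nat_eq_0_iff of_nat_mult)
qed

end
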